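(* For every $n\geq1$ there exists a bijection $\Psi:\mathbf{I}_n(021)\to\mathfrak{S}_n(2413,4213)$ such that for every $e\in\mathbf{I}_n(021)$, with $\pi=\Psi(e)$, $$\mathrm{DIST}(e)=\mathrm{VID}(\pi),\quad \mathrm{ASC}(e)=\mathrm{DES}(\pi),\quad \mathrm{ZERO}(e)=\mathrm{LMA}(\pi),$$ $$\mathrm{EMA}(e)=\mathrm{LMI}(\pi),\quad \mathrm{RMI}(e)=\mathrm{RMA}(\pi),\quad \mathrm{EXPO}(e)=\mathrm{RMI}(\pi).$$
   Context: $\mathbf{I}_n=\{(e_1,\ldots,e_n): 0\leq e_i<i\}$; $\mathbf{I}_n(021)$ is the set of $e\in\mathbf{I}_n$ with no $i<j<k$ such that $e_i<e_k<e_j$. $\mathfrak{S}_n(2413,4213)$ is the set of permutations $\pi$ of $\{1,\ldots,n\}$ containing no subsequence $\pi_a\pi_b\pi_c\pi_d$ ($a<b<c<d$) order-isomorphic to $2413$ or to $4213$. Statistics on $\pi\in\mathfrak{S}_n$: $\mathrm{DES}(\pi)=\{i\in[n-1]:\pi_i>\pi_{i+1}\}$; $\mathrm{VID}(\pi)=\{2\leq i\leq n: \text{the value }\pi_i+1\text{ appears to the left of position } i \text{ in }\pi\}$; $\mathrm{LMA}(\pi)=\{i:\pi_i>\pi_j\ \forall j<i\}$; $\mathrm{LMI}(\pi)=\{i:\pi_i<\pi_j\ \forall j<i\}$; $\mathrm{RMA}(\pi)=\{i:\pi_i>\pi_j\ \forall j>i\}$; $\mathrm{RMI}(\pi)=\{i:\pi_i<\pi_j\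 \forall j>i\}$. Statistics on $e\in\mathbf{I}_n$: $\mathrm{ASC}(e)=\{i\in[n-1]:e_i<e_{i+1}\}$; $\mathrm{DIST}(e)=\{2\leq i\leq n: e_i\neq0 \text{ and } e_i\neq e_j \text{ for all } j>i\}$; $\mathrm{ZERO}(e)=\{i:e_i=0\}$; $\mathrm{EMA}(e)=\{i: e_i=i-1\}$; $\mathrm{RMI}(e)=\{i: e_i<e_j\ \forall j>i\}$. For $e\in\mathbf{I}_n(021)$ define $d_i=e_i$ if $e_i\neq0$ and $d_i=\max\{e_1,\ldots,e_i\}$ if $e_i=0$; let $\mathcal{C}(e)=\{i: e_i=0\text{ and there exist } a<i<b \text{ with } e_a=e_b\neq0\}$; and $\mathrm{EXPO}(e)=\{i\in[n]: i\notin\mathcal{C}(e)\text{ and } i-d_i<j-d_j \text{ for all } j>i\}$. *)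

theory Defs
  imports "HOL-Library.FuncSet" "HOL-Combinatorics.Permutations"
begin

text \<open>
  A word \<open>w\<^sub>1 \<dots> w\<^sub>n\<close> is a function on the positions \<open>{1..n}\<close>. To make it
  determined by its entries, inversion sequences are taken extensional on \<open>{1..n}\<close>, and
  permutations fix everything outside \<open>{1..n}\<close>.
\<close>

definition inv_seqs :: "nat \<Rightarrow> (nat \<Rightarrow> nat) set" where
  "inv_seqs n = (\<Pi>\<^sub>E i\<in>{1..n}. {0..<i})"

definition inv_seqs_021 :: "nat \<Rightarrow> (nat \<Rightarrow> nat) set" where
  "inv_seqs_021 n = {e \<in> inv_seqs n.
     \<not> (\<exists>i j k. 1 \<le> i \<and> i < j \<and> j < k \<and> k \<le> n \<and> e i < e k \<and> e k < e j)}"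

definition contains_pattern :: "nat \<Rightarrow> (nat \<Rightarrow> nat) \<Rightarrow> nat list \<Rightarrow> bool" where
  "contains_pattern n w p \<longleftrightarrow>
     (\<exists>f. f \<in> {..<length p} \<rightarrow> {1..n} \<and> strict_mono_on {..<length p} f \<and>
          (\<forall>r<length p. \<forall>s<length p. w (f r) < w (f s) \<longleftrightarrow> p ! r < p ! s))"

definition perms_2413_4213 :: "nat \<Rightarrow> (nat \<Rightarrow> nat) set" where
  "perms_2413_4213 n = {\<pi>. \<pi> permutes {1..n} \<and>
     \<not> contains_pattern n \<pi> [2,4,1,3] \<and> \<not> contains_pattern n \<pi> [4,2,1,3]}"

definition DES :: "nat \<Rightarrow> (nat \<Rightarrow> nat) \<Rightarrow> nat set" where
  "DES n \<pi> = {i \<in> {1..n-1}. \<pi> i > \<pi> (i+1)}"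

definition VID :: "nat \<Rightarrow> (nat \<Rightarrow> nat) \<Rightarrow> nat set" where
  "VID n \<pi> = {i \<in> {2..n}. \<exists>j\<in>{1..<i}. \<pi> j = \<pi> i + 1}"

definition LMA :: "nat \<Rightarrow> (nat \<Rightarrow> nat) \<Rightarrow> nat set" where
  "LMA n \<pi> = {i \<in> {1..n}. \<forall>j\<in>{1..<i}. \<pi> i > \<pi> j}"

definition LMI :: "nat \<Rightarrow> (nat \<Rightarrow> nat) \<Rightarrow> nat set" where
  "LMI n \<pi> = {i \<in> {1..n}. \<forall>j\<in>{1..<i}. \<pi> i < \<pi> j}"

definition RMA :: "nat \<Rightarrow> (nat \<Rightarrow> nat) \<Rightarrow> nat set" where
  "RMA n \<pi> = {i \<in> {1..n}. \<forall>j\<in>{i<..n}. \<pi> i > \<pi> j}"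

text \<open>Used both for permutations and for inversion sequences.\<close>

definition RMI :: "nat \<Rightarrow> (nat \<Rightarrow> nat) \<Rightarrow> nat set" where
  "RMI n w = {i \<in> {1..n}. \<forall>j\<in>{i<..n}. w i < w j}"

definition ASC :: "nat \<Rightarrow> (nat \<Rightarrow> nat) \<Rightarrow> nat set" where
  "ASC n e = {i \<in> {1..n-1}. e i < e (i+1)}"

definition DIST :: "nat \<Rightarrow> (nat \<Rightarrow> nat) \<Rightarrow> nat set" where
  "DIST n e = {i \<in> {2..n}. e i \<noteq> 0 \<and> (\<forall>j\<in>{i<..n}. e i \<noteq> e j)}"

definition ZERO :: "nat \<Rightarrow> (nat \<Rightarrow> nat) \<Rightarrow> nat set" where
  "ZERO n e = {i \<in> {1..n}. e i = 0}"

definition EMA :: "nat \<Rightarrow> (nat \<Rightarrow> nat) \<Rightarrow> nat set" where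
  "EMA n e = {i \<in> {1..n}. e i = i - 1}"

definition expo_d :: "(nat \<Rightarrow> nat) \<Rightarrow> nat \<Rightarrow> nat" where
  "expo_d e i = (if e i \<noteq> 0 then e i else Max (e ` {1..i}))"

definition expo_C :: "nat \<Rightarrow> (nat \<Rightarrow> nat) \<Rightarrow> nat set" where
  "expo_C n e = {i \<in> {1..n}. e i = 0 \<and>
     (\<exists>a\<in>{1..<i}. \<exists>b\<in>{i<..n}. e a = e b \<and> e b \<noteq> 0)}"

definition EXPO :: "nat \<Rightarrow> (nat \<Rightarrow> nat) \<Rightarrow> nat set" where
  "EXPO n e = {i \<in> {1..n}. i \<notin> expo_C n e \<and>
     (\<forall>j\<in>{i<..n}. int i - int (expo_d e i) < int j - int (expo_d e j))}"

end

theory Submission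
  imports Defs
begin

text \<open>
  Both families are coded by the same lists of numbers. A sequence \<open>e\<close> is coded by
  \<open>0\<close> where \<open>e\<^sub>i = 0\<close> and by \<open>i - e\<^sub>i\<close> elsewhere. A permutation avoiding 2413 and 4213 is built by
  appending its entries from left to right: once \<open>\<pi>\<^sub>i\<close> lies below some earlier entries, no later entry
  may be inserted between two of these, so the admissible sites below the maximum form a stack;
  \<open>\<pi>\<^sub>i\<close> is coded by \<open>0\<close> if it is a new maximum and otherwise by the position of its site in that stack.
  In both cases the admissible codes are the sequences of starting heights of the up-steps in a Dyck
  path whose up-steps following an up-step have two colours, so they correspond to plane trees.

  Under this common coding the statistics ZERO and LMA, and EMA and LMI, agree, but DIST and VID, and
  EXPO and RMI, do not. Consider in the tree a node with nonzero code together with the chain of zeros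
  below it: the children attached to this chain form a word in children (\<open>Y\<close>) and steps towards
  the root along the chain (\<open>D\<close>). The node is in DIST iff its word does not start with \<open>Y\<close>, and
  in VID iff it does not end with \<open>Y\<close>. Hence rotating the pattern of every such word by one
  letter, with the subtrees kept in order, turns DIST into VID; it also turns EXPO into RMI.
  The remaining two pairs of statistics are functions of the pairs ZERO, LMA and DIST, VID.
\<close>

section \<open>Code lists\<close>

text \<open>Each zero raises the height by one, just as \<open>i - v\<close> grows with
  \<open>i\<close> for fixed \<open>v\<close>; so a first child at the far end of a chain repeats
  the value \<open>e\<^sub>i\<close> of the node. A child at the node itself takes the site between
  \<open>\<pi>\<^sub>i\<close> and the next larger earlier entry, so that
  \<open>\<pi>\<^sub>i + 1\<close> comes later. For the \<open>i\<close>-th zero (counted from 0) in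
  the chain of a nonzero node, EXPO and RMI both ask that nothing follows the subtree. EXPO asks
  moreover that the word does not start with \<open>Y\<close> and that every \<open>Y\<close> has
  more than \<open>i\<close> letters \<open>D\<close> after it; RMI asks for more than
  \<open>i + 1\<close>. Moving a leading \<open>D\<close> to the end adds one \<open>D\<close> after
  every \<open>Y\<close>, whereas a \<open>Y\<close> moved to the end has none after it: this is
  exactly the difference. The word of the root is not rotated. Its chain follows no nonzero code, so
  EXPO and RMI already agree there, and its pattern decides which codes equal 1, hence EMA and
  LMI.\<close>

text \<open>The first argument of \<open>valid\<close> and \<open>hgt\<close> is the current height of the path, that is, the
  largest code that may come next.\<close>

fun valid :: "nat \<Rightarrow> nat list \<Rightarrow> bool" where
  "valid h [] = True"
| "valid h (x # xs) = (if x = 0 then valid (Suc h) xs else x \<le> h \<and> valid (Suc x) xs)"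

fun hgt :: "nat \<Rightarrow> nat list \<Rightarrow> nat" where
  "hgt h [] = h"
| "hgt h (x # xs) = hgt (if x = 0 then Suc h else Suc x) xs"

text \<open>\<open>next_same j xs\<close>: an entry with code \<open>j\<close>, followed by \<open>xs\<close>, has the same value \<open>e\<^sub>i\<close> as
  the next nonzero one. \<open>reuse k xs\<close>: the \<open>k\<close>-th site is selected before it is removed from the
  stack.\<close>

fun next_same :: "nat \<Rightarrow> nat list \<Rightarrow> bool" where
  "next_same j [] = False"
| "next_same j (x # xs) = (if x = 0 then next_same (Suc j) xs else x = Suc j)"

fun reuse :: "nat \<Rightarrow> nat list \<Rightarrow> bool" where
  "reuse k [] = False"
| "reuse k (x # xs) = (if x = 0 \<or> k < x then reuse k xs else x = k)"

abbreviation above :: "nat \<Rightarrow> nat list \<Rightarrow> bool" where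
  "above k xs \<equiv> \<forall>y\<in>set xs. y = 0 \<or> k < y"

fun dist_flags :: "nat list \<Rightarrow> bool list" where
  "dist_flags [] = []"
| "dist_flags (x # xs) = (x \<noteq> 0 \<and> \<not> next_same x xs) # dist_flags xs"

fun vid_flags :: "nat list \<Rightarrow> bool list" where
  "vid_flags [] = []"
| "vid_flags (x # xs) = (x \<noteq> 0 \<and> \<not> reuse (Suc x) xs) # vid_flags xs"

text \<open>The Boolean argument records whether a nonzero code has already occurred.\<close>

fun expo_flags :: "bool \<Rightarrow> nat \<Rightarrow> nat list \<Rightarrow> bool list" where
  "expo_flags b h [] = []"
| "expo_flags b h (x # xs) =
     (if x \<noteq> 0 then above x xs
      else if b then \<not> next_same h xs \<and> above h xs
      else above (Suc h) xs)
     # expo_flags (b \<or> x \<noteq> 0) (if x = 0 then Suc h else Suc x) xs"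

fun rmi_flags :: "nat \<Rightarrow> nat list \<Rightarrow> bool list" where
  "rmi_flags h [] = []"
| "rmi_flags h (x # xs) =
     above (if x = 0 then Suc h else x) xs
     # rmi_flags (if x = 0 then Suc h else Suc x) xs"

lemma valid_replicate: "valid h (replicate t 0 @ xs) = valid (h + t) xs"
  by (induction t arbitrary: h) auto

lemma valid_append: "valid h (xs @ ys) \<longleftrightarrow> valid h xs \<and> valid (hgt h xs) ys"
  by (induction xs arbitrary: h) auto

lemma hgt_append: "hgt h (xs @ ys) = hgt (hgt h xs) ys"
  by (induction xs arbitrary: h) auto

text \<open>In a valid list every nonzero code is at most the current height, so the last one gives
  the sharpest bound and the bounds from all earlier ones follow. The version with every
  \<open>p\<close> is the one that weak increase of the nonzero \<open>e\<^sub>i\<close>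
  provides.\<close>

lemma valid_iff_nth:
  "valid h xs \<longleftrightarrow> (\<forall>i<length xs. xs ! i \<le> h + i) \<and>
     (\<forall>p i. p < i \<longrightarrow> i < length xs \<longrightarrow> xs ! p \<noteq> 0 \<longrightarrow> xs ! i \<le> xs ! p + (i - p))"
proof (induction xs arbitrary: h)
  case Nil
  then show ?case by simp
next
  case (Cons x xs)
  let ?Q = "\<lambda>xs :: nat list. \<forall>p i. p < i \<longrightarrow> i < length xs \<longrightarrow> xs ! p \<noteq> 0 \<longrightarrow> xs ! i \<le> xs ! p + (i - p)"
  have A: "(\<forall>i<length (x # xs). (x # xs) ! i \<le> h + i) \<longleftrightarrow> x \<le> h \<and> (\<forall>i<length xs. xs ! i \<le> Suc h + i)"
    by (simp add: All_less_Suc2)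
  have B: "?Q (x # xs) \<longleftrightarrow> ?Q xs \<and> (x \<noteq> 0 \<longrightarrow> (\<forall>i<length xs. xs ! i \<le> Suc x + i))"
  proof
    assume q: "?Q (x # xs)"
    have "?Q xs"
    proof (intro allI impI)
      fix p i assume "p < i" "i < length xs" "xs ! p \<noteq> 0"
      then show "xs ! i \<le> xs ! p + (i - p)" using q[rule_format, of "Suc p" "Suc i"] by simp
    qed
    moreover have "\<forall>i<length xs. xs ! i \<le> Suc x + i" if "x \<noteq> 0"
    proof (intro allI impI)
      fix i assume "i < length xs"
      then show "xs ! i \<le> Suc x + i" using q[rule_format, of 0 "Suc i"] that by simp
    qed
    ultimately show "?Q xs \<and> (x \<noteq> 0 \<longrightarrow> (\<forall>i<length xs. xs ! i \<le> Suc x + i))" by blast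
  next
    assume q: "?Q xs \<and> (x \<noteq> 0 \<longrightarrow> (\<forall>i<length xs. xs ! i \<le> Suc x + i))"
    show "?Q (x # xs)"
    proof (intro allI impI)
      fix p i assume a: "p < i" "i < length (x # xs)" "(x # xs) ! p \<noteq> 0"
      then obtain i' where i: "i = Suc i'" by (cases i) auto
      show "(x # xs) ! i \<le> (x # xs) ! p + (i - p)"
        using q a i by (cases p) auto
    qed
  qed
  have "(\<forall>i<length xs. xs ! i \<le> Suc x + i) \<Longrightarrow> x \<le> h \<Longrightarrow> (\<forall>i<length xs. xs ! i \<le> Suc h + i)"
    by (meson Suc_le_mono add_le_mono1 order_trans)
  then show ?case unfolding A B using Cons.IH by auto
qed

lemma dist_flags_nth:
  "i < length xs \<Longrightarrow> dist_flags xs ! i \<longleftrightarrow> xs ! i \<noteq> 0 \<and> \<not> next_same (xs ! i) (drop (Suc i) xs)"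
proof (induction xs arbitrary: i)
  case (Cons x xs)
  then show ?case by (cases i) auto
qed simp

lemma vid_flags_nth:
  "i < length xs \<Longrightarrow> vid_flags xs ! i \<longleftrightarrow> xs ! i \<noteq> 0 \<and> \<not> reuse (Suc (xs ! i)) (drop (Suc i) xs)"
proof (induction xs arbitrary: i)
  case (Cons x xs)
  then show ?case by (cases i) auto
qed simp

lemma rmi_flags_nth:
  "i < length xs \<Longrightarrow> rmi_flags h xs ! i \<longleftrightarrow>
     above (if xs ! i = 0 then hgt h (take (Suc i) xs) else xs ! i) (drop (Suc i) xs)"
proof (induction xs arbitrary: i h)
  case (Cons x xs)
  then show ?case by (cases i) auto
qed simp

lemma expo_flags_nth:
  "i < length xs \<Longrightarrow> expo_flags b h xs ! i \<longleftrightarrow>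
     (if xs ! i \<noteq> 0 then above (xs ! i) (drop (Suc i) xs)
      else if b \<or> (\<exists>p<i. xs ! p \<noteq> 0)
        then \<not> next_same (hgt h (take i xs)) (drop (Suc i) xs) \<and> above (hgt h (take i xs)) (drop (Suc i) xs)
      else above (Suc (hgt h (take i xs))) (drop (Suc i) xs))"
proof (induction xs arbitrary: i b h)
  case (Cons x xs)
  show ?case
  proof (cases i)
    case 0
    then show ?thesis by auto
  next
    case (Suc m)
    have "(b \<or> x \<noteq> 0) \<or> (\<exists>p<m. xs ! p \<noteq> 0) \<longleftrightarrow> b \<or> (\<exists>p<i. (x # xs) ! p \<noteq> 0)"
      by (auto simp: Suc Ex_less_Suc2)
    then show ?thesis
      using Cons.IH[of m "b \<or> x \<noteq> 0"] Cons.prems by (auto simp: Suc)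
  qed
qed simp

lemma next_same_iff:
  "next_same j xs \<longleftrightarrow> (\<exists>p<length xs. (\<forall>m<p. xs ! m = 0) \<and> xs ! p = Suc (j + p))"
proof (induction xs arbitrary: j)
  case (Cons x xs)
  then show ?case by (auto simp: Ex_less_Suc2 All_less_Suc2)
qed simp

lemma reuse_iff:
  "0 < k \<Longrightarrow> reuse k xs \<longleftrightarrow> (\<exists>p<length xs. (\<forall>m<p. xs ! m = 0 \<or> k < xs ! m) \<and> xs ! p = k)"
proof (induction xs)
  case (Cons x xs)
  then show ?case by (auto simp: Ex_less_Suc2 All_less_Suc2)
qed simp

section \<open>Trees\<close>

text \<open>The chain of a node consists of the node and the \<open>ndiv s\<close> zeros following it. Reading its word \<open>s\<close>
  from left to right, one starts at the far end of the chain; \<open>D\<close> moves one step towards the node, and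
  \<open>Y t r\<close> attaches a child with word \<open>t\<close> at the current element of the chain.\<close>

datatype word = E | D word | Y word word

fun ndiv :: "word \<Rightarrow> nat" where
  "ndiv E = 0"
| "ndiv (D r) = Suc (ndiv r)"
| "ndiv (Y s r) = ndiv r"

text \<open>\<open>H\<close> is the code of a child of the node itself; with \<open>ndiv r\<close>
  steps still to go towards the node, a child gets \<open>H + ndiv r\<close>. After a child with
  code \<open>k\<close> the height is \<open>Suc k\<close>, the base of its own word.\<close>

fun body :: "nat \<Rightarrow> word \<Rightarrow> nat list" where
  "body H E = []"
| "body H (D r) = body H r"
| "body H (Y s r) =
     (H + ndiv r) # replicate (ndiv s) 0 @ body (Suc (H + ndiv r)) s @ body H r"

text \<open>The root is the zero at position 1, and the other zeros of the initial run form its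
  chain. A child of the root itself gets the code 1.\<close>

definition enc :: "word \<Rightarrow> nat list" where
  "enc w = replicate (Suc (ndiv w)) 0 @ body 1 w"

lemma hd_body: "body H r \<noteq> [] \<Longrightarrow> hd (body H r) \<le> H + ndiv r \<and> H \<le> hd (body H r)"
  by (induction r) auto

lemma set_body_ge: "y \<in> set (body H w) \<Longrightarrow> y = 0 \<or> H \<le> y"
proof (induction w arbitrary: H)
  case (Y s r)
  then show ?case by (force split: if_splits)
qed auto

text \<open>\<open>B\<close> is only known to be valid from height \<open>H\<close>, while the
  height after \<open>body H w\<close> may be larger. As \<open>B\<close> is empty or starts with a
  nonzero code, which resets the height, more room does no harm.\<close>

lemma valid_body:
  "H + ndiv w \<le> h \<Longrightarrow> 0 < H \<Longrightarrow> valid H B \<Longrightarrow> B = [] \<or> 0 < hd B \<Longrightarrow> valid h (body H w @ B)"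
proof (induction w arbitrary: H h B)
  case E
  then show ?case by (cases B) auto
next
  case (D r)
  then show ?case by auto
next
  case (Y s r)
  let ?k = "H + ndiv r" and ?B = "body H r @ B"
  have 1: "valid (Suc ?k) ?B" using Y by auto
  have 2: "?B = [] \<or> 0 < hd ?B"
    using hd_body[of H r] Y.prems by (cases "body H r = []") auto
  have "valid (Suc ?k + ndiv s) (body (Suc ?k) s @ ?B)"
    by (rule Y.IH(1)) (use 1 2 in auto)
  then show ?case using Y.prems by (auto simp: valid_replicate)
qed

lemma valid_enc: "valid 0 (enc w)"
  using valid_body[of 1 w "Suc (ndiv w)" "[]"]
  by (simp add: enc_def valid_replicate del: replicate_Suc)

text \<open>The end of a subtree is visible in the list: below a child with code \<open>k\<close>
  there are only zeros and codes above \<open>k\<close>, while the next code outside is nonzero and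
  at most \<open>k\<close>.\<close>

lemma takeWhile_body:
  "takeWhile (\<lambda>x. x = 0 \<or> k < x) (replicate t 0 @ body (Suc k) s @ B) =
     replicate t 0 @ body (Suc k) s \<and>
   dropWhile (\<lambda>x. x = 0 \<or> k < x) (replicate t 0 @ body (Suc k) s @ B) = B"
  if "B = [] \<or> 0 < hd B \<and> hd B \<le> k"
proof -
  let ?P = "\<lambda>x. x = 0 \<or> k < x" and ?A = "replicate t 0 @ body (Suc k) s"
  have "\<And>x. x \<in> set ?A \<Longrightarrow> ?P x" using set_body_ge[of _ "Suc k" s] by force
  then have "takeWhile ?P (?A @ B) = ?A @ takeWhile ?P B" "dropWhile ?P (?A @ B) = dropWhile ?P B"
    by (simp_all only: takeWhile_append2 dropWhile_append2)
  moreover have "takeWhile ?P B = []" "dropWhile ?P B = B" using that by (cases B; auto)+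
  ultimately show ?thesis by simp
qed

lemma body_hd_cond: "0 < H \<Longrightarrow> body H r = [] \<or> 0 < hd (body H r) \<and> hd (body H r) \<le> H + ndiv r"
  using hd_body[of H r] by auto

lemma length_takeWhile_zeros:
  fixes xs :: "nat list"
  shows "xs = [] \<or> 0 < hd xs \<Longrightarrow> length (takeWhile (\<lambda>x. x = 0) (replicate t 0 @ xs)) = t"
proof (induction t)
  case 0
  then show ?case by (cases xs) auto
qed simp

text \<open>The head of the list reveals the first letter: it equals \<open>H + ndiv v\<close> for a
  leading \<open>Y\<close> and is smaller, if present, for a leading \<open>D\<close>. Leading
  \<open>D\<close>s leave no trace in \<open>body\<close>, so \<open>ndiv\<close> has to be
  given.\<close>

lemma body_inj:
  "0 < H \<Longrightarrow> body H v = body H w \<Longrightarrow> ndiv v = ndiv w \<Longrightarrow> v = w"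
\<comment> \<open>A leading \<open>D\<close> does not shorten the list, so the size of the word
  enters the measure.\<close>
proof (induction "length (body H v) + size v" arbitrary: H v w rule: less_induct)
  case less
  note IH = less.hyps and prems = less.prems
  have mixed: False if "body H (D r') = body H (Y s r)" "ndiv (D r') = ndiv (Y s r)" for r' s r
    using that hd_body[of H r'] by auto
  show ?case
  proof (cases v)
    case E
    then show ?thesis using prems by (cases w) auto
  next
    case (D r')
    then show ?thesis
    proof (cases w)
      case (D r)
      have "r' = r" by (rule IH) (use prems D \<open>v = D r'\<close> in simp_all)
      then show ?thesis using D \<open>v = D r'\<close> by simp
    next
      case (Y s r)
      then show ?thesis using prems mixed[of r' s r] D by simp
    qed (use prems D in simp)
  next
    case (Y s r)
    have "\<exists>s' r'. w = Y s' r'"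
    proof (cases w)
      case E
      then show ?thesis using prems(2) Y by simp
    next
      case (D r')
      then have "body H (D r') = body H (Y s r)" "ndiv (D r') = ndiv (Y s r)"
        using prems Y by (simp_all only:)
      then show ?thesis using mixed by blast
    qed blast
    then obtain s' r' where w: "w = Y s' r'" by blast
    let ?k = "H + ndiv r"
    have k: "ndiv r' = ndiv r" using prems(3) Y w by simp
    have eq: "replicate (ndiv s) 0 @ body (Suc ?k) s @ body H r =
        replicate (ndiv s') 0 @ body (Suc ?k) s' @ body H r'"
      using prems(2) unfolding Y w by (simp add: k)
    have c: "body H r = [] \<or> 0 < hd (body H r) \<and> hd (body H r) \<le> ?k"
      "body H r' = [] \<or> 0 < hd (body H r') \<and> hd (body H r') \<le> ?k"
      using body_hd_cond[of H] prems(1) k by metis+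
    have r: "body H r = body H r'"
      using takeWhile_body[OF c(1), of "ndiv s" s] takeWhile_body[OF c(2), of "ndiv s'" s'] eq
      by simp
    have s: "replicate (ndiv s) 0 @ body (Suc ?k) s = replicate (ndiv s') 0 @ body (Suc ?k) s'"
      using eq r by simp
    have tw: "length (takeWhile (\<lambda>x. x = 0) (replicate (ndiv s) 0 @ body (Suc ?k) s)) = ndiv s" for s
      using body_hd_cond[of "Suc ?k" s] by (intro length_takeWhile_zeros) auto
    have nd: "ndiv s = ndiv s'" using tw[of s] tw[of s'] s by simp
    then have bs: "body (Suc ?k) s = body (Suc ?k) s'" using s by simp
    have "s = s'" by (rule IH[of "Suc ?k"]) (use bs nd Y in simp_all)
    moreover have "r = r'" by (rule IH[of H]) (use r k Y prems(1) in simp_all)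
    ultimately show ?thesis using Y w by simp
  qed
qed

lemma enc_inj: "enc v = enc w \<Longrightarrow> v = w"
proof -
  assume a: "enc v = enc w"
  have tw: "length (takeWhile (\<lambda>x. x = 0) (enc w)) = Suc (ndiv w)" for w
    unfolding enc_def using body_hd_cond[of 1 w] by (intro length_takeWhile_zeros) auto
  have "ndiv v = ndiv w" using tw[of v] tw[of w] a by simp
  then show ?thesis using a body_inj[of 1 v w] by (simp add: enc_def)
qed

lemma ndiv_funpow: "ndiv ((D ^^ m) w) = m + ndiv w" "body H ((D ^^ m) w) = body H w"
  by (induction m) auto

lemma body_surj:
  "0 < H \<Longrightarrow> H \<le> h \<Longrightarrow> valid h xs \<Longrightarrow> xs = [] \<or> 0 < hd xs \<Longrightarrow> \<forall>y\<in>set xs. y = 0 \<or> H \<le> y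
   \<Longrightarrow> \<exists>w. ndiv w = h - H \<and> body H w = xs"
proof (induction "length xs" arbitrary: h H xs rule: less_induct)
  case less
  show ?case
  proof (cases xs)
    case Nil
    then show ?thesis by (intro exI[of _ "(D ^^ (h - H)) E"]) (simp add: ndiv_funpow)
  next
    case (Cons j ys)
    have j: "0 < j" "H \<le> j" "j \<le> h" "valid (Suc j) ys" using Cons less.prems by auto
    \<comment> \<open>\<open>A\<close> holds the chain and the subtree of the child with code
      \<open>j\<close>, \<open>B\<close> its later siblings.\<close>
    define A where "A = takeWhile (\<lambda>x. x = 0 \<or> j < x) ys"
    define B where "B = dropWhile (\<lambda>x. x = 0 \<or> j < x) ys"
    define t where "t = length (takeWhile (\<lambda>x. x = 0) A)"
    define A' where "A' = dropWhile (\<lambda>x. x = 0) A"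
    have ys: "ys = A @ B" unfolding A_def B_def by simp
    have A: "A = replicate t 0 @ A'"
    proof -
      have "takeWhile (\<lambda>x. x = 0) A = replicate t 0"
        unfolding t_def by (metis (mono_tags) replicate_length_same set_takeWhileD)
      then show ?thesis unfolding A'_def by (metis takeWhile_dropWhile_id)
    qed
    have len: "length A' < length xs" "length B < length xs"
      using Cons ys A by auto
    have hdB: "B = [] \<or> 0 < hd B \<and> hd B \<le> j"
      unfolding B_def by (metis (mono_tags, lifting) hd_dropWhile linorder_not_less neq0_conv)
    have vB: "valid j B"
      using j(4) hdB unfolding ys valid_append by (cases B) auto
    have "\<exists>r. ndiv r = j - H \<and> body H r = B"
      by (rule less.hyps) (use less.prems Cons ys j len vB hdB in auto)
    then obtain r where r: "ndiv r = j - H" "body H r = B" by blast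
    have vA: "valid (Suc j + t) A'"
      using j(4) by (simp add: ys A valid_replicate) (simp add: valid_append)
    have "\<forall>y\<in>set A. y = 0 \<or> Suc j \<le> y"
      unfolding A_def by (auto dest: set_takeWhileD)
    then have gA: "\<forall>y\<in>set A'. y = 0 \<or> Suc j \<le> y" using A by auto
    have hA: "A' = [] \<or> 0 < hd A'"
      unfolding A'_def by (metis (mono_tags, lifting) hd_dropWhile neq0_conv)
    have "\<exists>s. ndiv s = Suc j + t - Suc j \<and> body (Suc j) s = A'"
      by (rule less.hyps) (use len vA gA hA in auto)
    then obtain s where s: "ndiv s = t" "body (Suc j) s = A'" by auto
    \<comment> \<open>The \<open>h - j\<close> leading \<open>D\<close>s are the descent from the
      far end of the chain, at height \<open>h\<close>, to the first child.\<close>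
    show ?thesis
      by (intro exI[of _ "(D ^^ (h - j)) (Y s r)"])
        (use r s j Cons ys A in \<open>simp add: ndiv_funpow\<close>)
  qed
qed

lemma enc_surj:
  assumes "valid 0 xs" "xs \<noteq> []"
  shows "\<exists>w. enc w = xs"
proof -
  define t where "t = length (takeWhile (\<lambda>x. x = 0) xs)"
  define A where "A = dropWhile (\<lambda>x. x = 0) xs"
  have "takeWhile (\<lambda>x. x = 0) xs = replicate t 0"
    unfolding t_def by (metis (mono_tags) replicate_length_same set_takeWhileD)
  then have xs: "xs = replicate t 0 @ A" unfolding A_def by (metis takeWhile_dropWhile_id)
  have t: "0 < t" using assms by (cases xs) (auto simp: t_def split: if_splits)
  have "\<exists>w. ndiv w = t - 1 \<and> body 1 w = A"
    by (rule body_surj)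
      (use assms t in \<open>auto simp: xs valid_replicate\<close>,
       metis (mono_tags, lifting) A_def hd_dropWhile neq0_conv)
  then obtain w where "ndiv w = t - 1" "body 1 w = A" by blast
  then show ?thesis using t xs by (intro exI[of _ w]) (simp add: enc_def del: replicate_Suc)
qed

section \<open>Rotation\<close>

fun snoc_div :: "word \<Rightarrow> word" where
  "snoc_div E = D E"
| "snoc_div (D r) = D (snoc_div r)"
| "snoc_div (Y s r) = Y s (snoc_div r)"

text \<open>\<open>shift s r\<close> moves the letter \<open>Y\<close> from the front of \<open>Y s r\<close> to the end, while the subtrees stay
  in order.\<close>

fun shift :: "word \<Rightarrow> word \<Rightarrow> word" where
  "shift s E = Y s E"
| "shift s (D r) = D (shift s r)"
| "shift s (Y s' r) = Y s (shift s' r)"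

fun rot :: "word \<Rightarrow> word" where
  "rot E = E"
| "rot (D r) = snoc_div r"
| "rot (Y s r) = shift s r"

fun rot_subs :: "word \<Rightarrow> word" where
  "rot_subs E = E"
| "rot_subs (D r) = D (rot_subs r)"
| "rot_subs (Y s r) = Y (rot (rot_subs s)) (rot_subs r)"

fun starts_Y :: "word \<Rightarrow> bool" where
  "starts_Y (Y s r) = True"
| "starts_Y _ = False"

fun ends_Y :: "word \<Rightarrow> bool" where
  "ends_Y E = False"
| "ends_Y (D r) = ends_Y r"
| "ends_Y (Y s r) = (ndiv r = 0 \<or> ends_Y r)"

fun no_Y :: "word \<Rightarrow> bool" where
  "no_Y E = True"
| "no_Y (D r) = no_Y r"
| "no_Y (Y s r) = False"

text \<open>All children sit at least \<open>i\<close> chain steps away from the node.\<close>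

fun all_Y :: "nat \<Rightarrow> word \<Rightarrow> bool" where
  "all_Y i E = True"
| "all_Y i (D r) = all_Y i r"
| "all_Y i (Y s r) = (i \<le> ndiv r \<and> all_Y i r)"

lemma snoc_div_neq_E [simp]: "snoc_div r \<noteq> E" "E \<noteq> snoc_div r"
  by (cases r; simp)+

lemma shift_neq_E [simp]: "shift s r \<noteq> E" "E \<noteq> shift s r"
  by (cases r; simp)+

lemma snoc_div_inj: "snoc_div v = snoc_div w \<Longrightarrow> v = w"
proof (induction v arbitrary: w)
  case E
  then show ?case by (cases w) auto
next
  case (D r)
  then show ?case by (cases w) auto
next
  case (Y s r)
  then show ?case by (cases w) auto
qed

lemma shift_inj: "shift s v = shift s' w \<Longrightarrow> s = s' \<and> v = w"
proof (induction s v arbitrary: s' w rule: shift.induct)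
  case (1 s)
  then show ?case by (cases w) simp_all
next
  case (2 s r)
  then show ?case by (cases w) simp_all
next
  case (3 s t r)
  show ?case
  proof (cases w)
    case (Y t' r')
    then show ?thesis using 3 by simp
  qed (use 3 in simp_all)
qed

lemma ends_Y_rot_aux: "\<not> ends_Y (snoc_div r)" "ends_Y (shift s r)"
proof -
  have nd: "ndiv (snoc_div r) \<noteq> 0" for r by (induction r) auto
  show "\<not> ends_Y (snoc_div r)" using nd by (induction r) auto
  show "ends_Y (shift s r)" by (induction r arbitrary: s) auto
qed

lemma ends_Y_rot: "ends_Y (rot s) = starts_Y s"
  using ends_Y_rot_aux by (cases s) auto

lemma rot_eq_E: "rot v = E \<longleftrightarrow> v = E"
  by (cases v) auto

text \<open>The last letter of \<open>rot v\<close> shows which letter led \<open>v\<close>; once it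
  is known, the move can be undone.\<close>

lemma rot_inj: "rot v = rot w \<Longrightarrow> v = w"
proof -
  assume a: "rot v = rot w"
  then have "starts_Y v = starts_Y w" using ends_Y_rot by metis
  then show "v = w" using a rot_eq_E[of v] rot_eq_E[of w]
    by (cases v; cases w) (auto dest: snoc_div_inj shift_inj)
qed

lemma rot_subs_inj: "rot_subs v = rot_subs w \<Longrightarrow> v = w"
proof (induction v arbitrary: w)
  case (Y s r)
  then show ?case by (cases w) (auto dest: rot_inj)
next
  case E
  then show ?case by (cases w) auto
next
  case (D r)
  then show ?case by (cases w) auto
qed

lemma ndiv_snoc_div: "ndiv (snoc_div r) = Suc (ndiv r)"
  by (induction r) auto

lemma ndiv_shift: "ndiv (shift s r) = ndiv r"
  by (induction r arbitrary: s) auto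

lemma ndiv_rot: "ndiv (rot s) = ndiv s"
  by (cases s) (auto simp: ndiv_snoc_div ndiv_shift)

lemma ndiv_rot_subs: "ndiv (rot_subs s) = ndiv s"
  by (induction s) auto

lemma starts_Y_rot_subs: "starts_Y (rot_subs s) = starts_Y s"
  by (cases s) auto

lemma no_Y_rot_subs: "no_Y (rot_subs s) = no_Y s"
  by (induction s) auto

lemma all_Y_rot_subs: "all_Y i (rot_subs s) = all_Y i s"
  by (induction s) (auto simp: ndiv_rot_subs)

lemma all_Y_snoc_div: "all_Y (Suc i) (snoc_div r) = all_Y i r"
  by (induction r) (auto simp: ndiv_snoc_div)

lemma all_Y_shift: "\<not> all_Y (Suc i) (shift s r)"
  by (induction r arbitrary: s) auto

lemma all_Y_rot: "all_Y (Suc i) (rot s) \<longleftrightarrow> \<not> starts_Y s \<and> all_Y i s"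
  by (cases s) (auto simp: all_Y_snoc_div all_Y_shift)

section \<open>Flags read off the tree\<close>

fun zeros_word :: "word \<Rightarrow> bool list" where
  "zeros_word E = []"
| "zeros_word (D r) = zeros_word r"
| "zeros_word (Y s r) = False # replicate (ndiv s) True @ zeros_word s @ zeros_word r"

text \<open>With \<open>P = starts_Y\<close> this gives DIST, with \<open>P = ends_Y\<close> VID;
  \<open>s\<close> is the word of the flagged node, and the zeros of its chain are never
  flagged.\<close>

fun flags_word :: "(word \<Rightarrow> bool) \<Rightarrow> word \<Rightarrow> bool list" where
  "flags_word P E = []"
| "flags_word P (D r) = flags_word P r"
| "flags_word P (Y s r) = (\<not> P s) # replicate (ndiv s) False @ flags_word P s @ flags_word P r"

text \<open>Common form of EXPO and RMI: \<open>l\<close> says that nothing follows the word in the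
  whole list, and \<open>P i s\<close> is the condition on the \<open>i\<close>-th zero in the chain
  of a child with word \<open>s\<close>.\<close>

fun last_flags_word :: "(nat \<Rightarrow> word \<Rightarrow> bool) \<Rightarrow> bool \<Rightarrow> word \<Rightarrow> bool list" where
  "last_flags_word P l E = []"
| "last_flags_word P l (D r) = last_flags_word P l r"
| "last_flags_word P l (Y s r) =
     (l \<and> no_Y r) # map (\<lambda>i. l \<and> no_Y r \<and> P i s) [0..<ndiv s]
       @ last_flags_word P (l \<and> no_Y r) s @ last_flags_word P l r"

text \<open>A rotation keeps the sequence of subtrees, and the flags below a node depend on this
  sequence only, not on where the children sit on the chain. The same holds for
  \<open>flags_word\<close> and \<open>last_flags_word\<close>.\<close>

lemma zeros_word_rot: "zeros_word (rot s) = zeros_word s"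
proof -
  have "zeros_word (snoc_div r) = zeros_word r" for r by (induction r) auto
  moreover have "zeros_word (shift s r) = zeros_word (Y s r)" for s r
    by (induction r arbitrary: s) auto
  ultimately show ?thesis by (cases s) auto
qed

lemma zeros_word_rot_subs: "zeros_word (rot_subs s) = zeros_word s"
  by (induction s) (auto simp: zeros_word_rot ndiv_rot ndiv_rot_subs)

lemma flags_word_rot: "flags_word P (rot s) = flags_word P s"
proof -
  have "flags_word P (snoc_div r) = flags_word P r" for r by (induction r) auto
  moreover have "flags_word P (shift s r) = flags_word P (Y s r)" for s r
    by (induction r arbitrary: s) auto
  ultimately show ?thesis by (cases s) auto
qed

lemma flags_word_rot_subs: "flags_word ends_Y (rot_subs s) = flags_word starts_Y s"
  by (induction s) (auto simp: flags_word_rot ndiv_rot ndiv_rot_subs ends_Y_rot starts_Y_rot_subs)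

lemma last_flags_word_rot: "last_flags_word P l (rot s) = last_flags_word P l s"
proof -
  have n1: "no_Y (snoc_div r) = no_Y r" for r by (induction r) auto
  have n2: "\<not> no_Y (shift s r)" for s r by (induction r arbitrary: s) auto
  have "last_flags_word P l (snoc_div r) = last_flags_word P l r" for r
    by (induction r) (auto simp: n1)
  moreover have "last_flags_word P l (shift s r) = last_flags_word P l (Y s r)" for s r
    by (induction r arbitrary: s) (auto simp: n2)
  ultimately show ?thesis by (cases s) auto
qed

lemma last_flags_word_rot_subs:
  "last_flags_word (\<lambda>i. all_Y (Suc (Suc i))) l (rot_subs s) =
   last_flags_word (\<lambda>i s. \<not> starts_Y s \<and> all_Y (Suc i) s) l s"
  by (induction s arbitrary: l)
    (auto simp: last_flags_word_rot ndiv_rot ndiv_rot_subs all_Y_rot starts_Y_rot_subs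
      all_Y_rot_subs no_Y_rot_subs)

section \<open>Flags of the list encoded by a word\<close>

lemma next_same_replicate: "next_same j (replicate t 0 @ xs) = next_same (j + t) xs"
  by (induction t arbitrary: j) auto

lemma reuse_above: "above k xs \<Longrightarrow> reuse k (xs @ ys) = reuse k ys"
  by (induction xs) auto

lemma dist_flags_replicate: "dist_flags (replicate t 0 @ xs) = replicate t False @ dist_flags xs"
  by (induction t) auto

lemma vid_flags_replicate: "vid_flags (replicate t 0 @ xs) = replicate t False @ vid_flags xs"
  by (induction t) auto

lemma expo_flags_replicate:
  "expo_flags True (Suc k) (replicate t 0 @ xs) =
     map (\<lambda>i. \<not> next_same (k + t) xs \<and> above (k + Suc i) xs) [0..<t] @ expo_flags True (Suc k + t) xs"
proof (induction t arbitrary: k)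
  case (Suc t)
  show ?case using Suc[of "Suc k"]
    by (auto simp: map_upt_Suc next_same_replicate simp del: upt_Suc)
qed simp

lemma expo_flags_replicate_False:
  "expo_flags False h (replicate t 0 @ xs) =
     map (\<lambda>i. above (h + Suc i) xs) [0..<t] @ expo_flags False (h + t) xs"
proof (induction t arbitrary: h)
  case (Suc t)
  show ?case using Suc[of "Suc h"]
    by (auto simp: map_upt_Suc simp del: upt_Suc)
qed simp

lemma rmi_flags_replicate:
  "rmi_flags h (replicate t 0 @ xs) =
     map (\<lambda>i. above (h + Suc i) xs) [0..<t] @ rmi_flags (h + t) xs"
proof (induction t arbitrary: h)
  case (Suc t)
  show ?case using Suc[of "Suc h"]
    by (auto simp: map_upt_Suc simp del: upt_Suc)
qed simp

text \<open>If anything follows a body with base \<open>H\<close>, it is a node attached closer to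
  the root, hence with a nonzero code below \<open>H\<close>.\<close>

abbreviation low :: "nat \<Rightarrow> nat list \<Rightarrow> bool" where
  "low k B \<equiv> B = [] \<or> 0 < hd B \<and> hd B < k"

lemma low_body:
  assumes "0 < H" "low H B"
  shows "low (Suc (H + ndiv r)) (body H r @ B)"
  using body_hd_cond[OF assms(1), of r] assms by (cases "body H r = []") auto

text \<open>A leading \<open>Y\<close> has the code \<open>Suc (k + ndiv s)\<close>. After a leading
  \<open>D\<close>, or without children, the next code is smaller.\<close>

lemma next_same_body:
  assumes "low (Suc k) B"
  shows "next_same (k + ndiv s) (body (Suc k) s @ B) = starts_Y s"
proof -
  have *: "next_same m xs \<longleftrightarrow> xs \<noteq> [] \<and> hd xs = Suc m" if "xs = [] \<or> 0 < hd xs" for m xs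
    using that by (cases xs) auto
  show ?thesis
  proof (cases s)
    case E
    then show ?thesis using assms by (subst *) auto
  next
    case (D r)
    then show ?thesis using assms low_body[of "Suc k" B r] by (subst *) auto
  next
    case (Y t r)
    then show ?thesis by simp
  qed
qed

text \<open>The nonzero codes in \<open>body k s\<close> are at least \<open>k\<close>, with
  equality only for a child that has no \<open>D\<close> after it; what follows the body is below
  \<open>k\<close> and ends the search.\<close>

lemma reuse_body: "0 < k \<Longrightarrow> low k B \<Longrightarrow> reuse k (body k s @ B) = ends_Y s"
proof (induction s)
  case E
  then show ?case by (cases B) auto
next
  case (D r)
  then show ?case by simp
next
  case (Y s r)
  have "above k (replicate (ndiv s) 0 @ body (Suc (k + ndiv r)) s)"
    using set_body_ge[of _ "Suc (k + ndiv r)" s] by fastforce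
  from reuse_above[OF this] show ?case using Y by simp
qed

lemma above_replicate: "above k (replicate t 0 @ xs) \<longleftrightarrow> above k xs"
  by auto

lemma all_Y_0: "all_Y 0 s"
  by (induction s) auto

text \<open>Codes deeper in a subtree exceed the code of its top node, so only the children
  themselves matter.\<close>

lemma above_body: "above (k + i) (body (Suc k) s) \<longleftrightarrow> all_Y i s"
proof (induction s)
  case (Y s r)
  have "i \<le> ndiv r \<Longrightarrow> above (k + i) (replicate (ndiv s) 0 @ body (Suc (Suc k + ndiv r)) s)"
    using set_body_ge[of _ "Suc (Suc k + ndiv r)" s] by fastforce
  then show ?case using Y.IH(2) by (auto simp: ball_Un)
qed auto

lemma body_eq_Nil: "body H r = [] \<longleftrightarrow> no_Y r"
  by (induction r) auto

lemma not_above_low: "low (Suc k) B \<Longrightarrow> above (k + i) B \<longleftrightarrow> B = []"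
  by (cases B) auto

lemma above_body_append:
  assumes "low (Suc k) B"
  shows "above (k + i) (body (Suc k) s @ B) \<longleftrightarrow> B = [] \<and> all_Y i s"
  unfolding set_append ball_Un above_body not_above_low[OF assms] by blast

lemma zeros_body: "0 < H \<Longrightarrow> map (\<lambda>x. x = 0) (body H w) = zeros_word w"
  by (induction w arbitrary: H) auto

lemma dist_flags_body:
  "0 < H \<Longrightarrow> low H B \<Longrightarrow> dist_flags (body H w @ B) = flags_word starts_Y w @ dist_flags B"
proof (induction w arbitrary: H B)
  case (Y s r)
  note l = low_body[OF Y.prems, of r]
  show ?case using Y.IH(1)[OF _ l] Y.IH(2)[OF Y.prems] next_same_body[OF l, of s] Y.prems
    by (simp add: dist_flags_replicate next_same_replicate)
qed auto

lemma vid_flags_body: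
  "0 < H \<Longrightarrow> low H B \<Longrightarrow> vid_flags (body H w @ B) = flags_word ends_Y w @ vid_flags B"
proof (induction w arbitrary: H B)
  case (Y s r)
  note l = low_body[OF Y.prems, of r]
  have "reuse (Suc (H + ndiv r)) (replicate (ndiv s) 0 @ xs) = reuse (Suc (H + ndiv r)) xs" for xs
    by (rule reuse_above) auto
  then show ?case using Y.IH(1)[OF _ l] Y.IH(2)[OF Y.prems] reuse_body[OF _ l, of s] Y.prems
    by (simp add: vid_flags_replicate)
qed auto

text \<open>The body and \<open>B\<close> are empty or start with a nonzero code, which overwrites
  both the Boolean and the height. Hence \<open>b\<close> and \<open>h\<close> are arbitrary on the
  left, and the state \<open>True\<close>, \<open>0\<close> on the right is a dummy.\<close>

lemma expo_flags_body:
  "0 < H \<Longrightarrow> low H B \<Longrightarrow> expo_flags b h (body H w @ B) =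
     last_flags_word (\<lambda>i s. \<not> starts_Y s \<and> all_Y (Suc i) s) (B = []) w @ expo_flags True 0 B"
proof (induction w arbitrary: H B b h)
  case E
  then show ?case by (cases B) auto
next
  case (D r)
  then show ?case by simp
next
  case (Y s r)
  let ?B = "body H r @ B" and ?k = "H + ndiv r"
  note l = low_body[OF Y.prems, of r]
  have B: "?B = [] \<longleftrightarrow> B = [] \<and> no_Y r" by (auto simp: body_eq_Nil)
  have ab: "above (?k + i) (body (Suc ?k) s @ ?B) \<longleftrightarrow> B = [] \<and> no_Y r \<and> all_Y i s" for i
    unfolding above_body_append[OF l] B by blast
  have "above ?k (replicate (ndiv s) 0 @ body (Suc ?k) s @ ?B) \<longleftrightarrow> B = [] \<and> no_Y r"
    using ab[of 0] unfolding above_replicate by (simp add: all_Y_0)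
  moreover have "expo_flags True (Suc ?k) (replicate (ndiv s) 0 @ body (Suc ?k) s @ ?B) =
     map (\<lambda>i. B = [] \<and> no_Y r \<and> \<not> starts_Y s \<and> all_Y (Suc i) s) [0..<ndiv s] @
     last_flags_word (\<lambda>i s. \<not> starts_Y s \<and> all_Y (Suc i) s) (B = [] \<and> no_Y r) s @
     last_flags_word (\<lambda>i s. \<not> starts_Y s \<and> all_Y (Suc i) s) (B = []) r @ expo_flags True 0 B"
    unfolding expo_flags_replicate next_same_body[OF l] ab
    using Y.IH(1)[OF _ l] Y.IH(2)[OF Y.prems] B by auto
  ultimately show ?case using Y.prems by simp
qed

lemma rmi_flags_body:
  "0 < H \<Longrightarrow> low H B \<Longrightarrow> rmi_flags h (body H w @ B) =
     last_flags_word (\<lambda>i. all_Y (Suc (Suc i))) (B = []) w @ rmi_flags 0 B"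
proof (induction w arbitrary: H B h)
  case E
  then show ?case by (cases B) auto
next
  case (D r)
  then show ?case by simp
next
  case (Y s r)
  let ?B = "body H r @ B" and ?k = "H + ndiv r"
  note l = low_body[OF Y.prems, of r]
  have B: "?B = [] \<longleftrightarrow> B = [] \<and> no_Y r" by (auto simp: body_eq_Nil)
  have sh: "Suc ?k + Suc i = ?k + Suc (Suc i)" for i by simp
  have ab: "above (?k + i) (body (Suc ?k) s @ ?B) \<longleftrightarrow> B = [] \<and> no_Y r \<and> all_Y i s" for i
    unfolding above_body_append[OF l] B by blast
  have "above ?k (replicate (ndiv s) 0 @ body (Suc ?k) s @ ?B) \<longleftrightarrow> B = [] \<and> no_Y r"
    using ab[of 0] unfolding above_replicate by (simp add: all_Y_0)
  moreover have "rmi_flags (Suc ?k) (replicate (ndiv s) 0 @ body (Suc ?k) s @ ?B) =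
     map (\<lambda>i. B = [] \<and> no_Y r \<and> all_Y (Suc (Suc i)) s) [0..<ndiv s] @
     last_flags_word (\<lambda>i. all_Y (Suc (Suc i))) (B = [] \<and> no_Y r) s @
     last_flags_word (\<lambda>i. all_Y (Suc (Suc i))) (B = []) r @ rmi_flags 0 B"
    unfolding rmi_flags_replicate sh ab
    using Y.IH(1)[OF _ l] Y.IH(2)[OF Y.prems] B by auto
  ultimately show ?case using Y.prems by simp
qed

lemma enc_rot_subs_zeros: "map (\<lambda>x. x = 0) (enc (rot_subs w)) = map (\<lambda>x. x = 0) (enc w)"
  by (simp add: enc_def zeros_body zeros_word_rot_subs ndiv_rot_subs)

lemma length_enc_rot_subs: "length (enc (rot_subs w)) = length (enc w)"
  using arg_cong[OF enc_rot_subs_zeros, of length w] by simp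

text \<open>Code 1 belongs to the children of the root itself: every deeper body has base at least
  2, and the pattern of the root word is kept.\<close>

lemma enc_rot_subs_ones: "map (\<lambda>x. x = 1) (enc (rot_subs w)) = map (\<lambda>x. x = 1) (enc w)"
proof -
  have len: "length (body H w) = length (zeros_word w)" if "0 < H" for H w
    using arg_cong[OF zeros_body[OF that], of length w] by simp
  have big: "map (\<lambda>x. x = 1) (body H w) = replicate (length (zeros_word w)) False" if "1 < H" for H w
  proof -
    have "map (\<lambda>x. x = 1) (body H w) = map (\<lambda>x. False) (body H w)"
      using set_body_ge[of _ H w] that by (intro map_cong) force+
    then show ?thesis using len that by (simp add: map_replicate_const)
  qed
  have "map (\<lambda>x. x = 1) (body 1 (rot_subs w)) = map (\<lambda>x. x = 1) (body 1 w)"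
    by (induction w) (auto simp: big[simplified] ndiv_rot ndiv_rot_subs zeros_word_rot zeros_word_rot_subs)
  then show ?thesis by (simp add: enc_def ndiv_rot_subs)
qed

lemma vid_flags_enc_rot_subs: "vid_flags (enc (rot_subs w)) = dist_flags (enc w)"
  using dist_flags_body[of 1 "[]" w] vid_flags_body[of 1 "[]" "rot_subs w"]
  by (simp add: enc_def vid_flags_replicate dist_flags_replicate flags_word_rot_subs ndiv_rot_subs
      del: replicate_Suc)

text \<open>On the initial run of zeros, where \<open>d\<^sub>i = 0\<close>, the two conditions
  coincide without a shift, in accordance with the unrotated root word.\<close>

lemma rmi_flags_enc_rot_subs: "rmi_flags 0 (enc (rot_subs w)) = expo_flags False 0 (enc w)"
  using expo_flags_body[of 1 "[]" False "Suc (ndiv w)" w]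
    rmi_flags_body[of 1 "[]" "Suc (ndiv w)" "rot_subs w"] above_body[where k = 0]
  by (simp add: enc_def expo_flags_replicate_False rmi_flags_replicate last_flags_word_rot_subs
      ndiv_rot_subs all_Y_rot_subs del: replicate_Suc upt_Suc)

section \<open>Permutations\<close>

definition is_lma :: "(nat \<Rightarrow> nat) \<Rightarrow> nat \<Rightarrow> bool" where
  "is_lma \<pi> i \<longleftrightarrow> (\<forall>j\<in>{1..<i}. \<pi> j < \<pi> i)"

text \<open>The positions \<open>p\<close> for which the site just below the value \<open>\<pi> p\<close> is admissible after \<open>k\<close> steps.\<close>

definition open_pos :: "(nat \<Rightarrow> nat) \<Rightarrow> nat \<Rightarrow> nat set" where
  "open_pos \<pi> k = {p \<in> {1..k}.
     \<not> (\<exists>i q. p < i \<and> i \<le> k \<and> 1 \<le> q \<and> q < i \<and> \<pi> i < \<pi> q \<and> \<pi> q < \<pi> p)}"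

text \<open>Sites are numbered from the bottom, starting with 1 because 0 marks a new
  maximum.\<close>

definition code :: "(nat \<Rightarrow> nat) \<Rightarrow> nat \<Rightarrow> nat" where
  "code \<pi> i = (if is_lma \<pi> i then 0 else Suc (card {p \<in> open_pos \<pi> (i - 1). \<pi> p < \<pi> i}))"

definition codes :: "nat \<Rightarrow> (nat \<Rightarrow> nat) \<Rightarrow> nat list" where
  "codes n \<pi> = map (code \<pi>) [1..<Suc n]"

lemma codes_Suc: "codes (Suc n) \<pi> = codes n \<pi> @ [code \<pi> (Suc n)]"
  by (simp add: codes_def)

lemma length_codes [simp]: "length (codes n \<pi>) = n"
  by (simp add: codes_def)

lemma codes_nth: "i < n \<Longrightarrow> codes n \<pi> ! i = code \<pi> (Suc i)"
  by (simp add: codes_def del: upt_Suc)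

lemma open_pos_subset: "open_pos \<pi> k \<subseteq> {1..k}"
  by (auto simp: open_pos_def)

lemma finite_open_pos [simp]: "finite (open_pos \<pi> k)"
  using open_pos_subset finite_subset by blast

lemma open_posD:
  "p \<in> open_pos \<pi> k \<Longrightarrow> p < i \<Longrightarrow> i \<le> k \<Longrightarrow> 1 \<le> q \<Longrightarrow> q < i \<Longrightarrow> \<pi> i < \<pi> q \<Longrightarrow> \<pi> q < \<pi> p \<Longrightarrow> False"
  unfolding open_pos_def by blast

lemma open_posI:
  assumes "1 \<le> p" "p \<le> k"
    "\<And>i q. p < i \<Longrightarrow> i \<le> k \<Longrightarrow> 1 \<le> q \<Longrightarrow> q < i \<Longrightarrow> \<pi> i < \<pi> q \<Longrightarrow> \<pi> q < \<pi> p \<Longrightarrow> False"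
  shows "p \<in> open_pos \<pi> k"
  unfolding open_pos_def using assms by (simp only: mem_Collect_eq atLeastAtMost_iff) blast

lemma open_pos_bounds: "p \<in> open_pos \<pi> k \<Longrightarrow> 1 \<le> p \<and> p \<le> k"
  using open_pos_subset by fastforce

lemma open_pos_mono: "p \<in> open_pos \<pi> k \<Longrightarrow> p \<le> k' \<Longrightarrow> k' \<le> k \<Longrightarrow> p \<in> open_pos \<pi> k'"
  by (rule open_posI) (auto dest: open_pos_bounds intro: open_posD[of p \<pi> k])

lemma open_pos_self: "1 \<le> k \<Longrightarrow> k \<in> open_pos \<pi> k"
  by (rule open_posI) auto

text \<open>A site is labelled by the entry that bounds it from above; \<open>x\<close> labels the
  site taken by \<open>\<pi> i\<close>.\<close>

definition next_larger :: "(nat \<Rightarrow> nat) \<Rightarrow> nat \<Rightarrow> nat \<Rightarrow> bool" where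
  "next_larger \<pi> i x \<longleftrightarrow> 1 \<le> x \<and> x < i \<and> \<pi> i < \<pi> x \<and>
     (\<forall>p. 1 \<le> p \<longrightarrow> p < i \<longrightarrow> \<pi> i < \<pi> p \<longrightarrow> \<pi> x \<le> \<pi> p)"

lemma next_largerD:
  assumes "next_larger \<pi> i x"
  shows "1 \<le> x" "x < i" "\<pi> i < \<pi> x"
    "\<And>p. 1 \<le> p \<Longrightarrow> p < i \<Longrightarrow> \<pi> i < \<pi> p \<Longrightarrow> \<pi> x \<le> \<pi> p"
  using assms unfolding next_larger_def by blast+

text \<open>2413 and 4213 differ only in the order of their first two letters, so leaving the order
  of \<open>p\<close> and \<open>q\<close> open covers both.\<close>

definition avoids :: "nat \<Rightarrow> (nat \<Rightarrow> nat) \<Rightarrow> bool" where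
  "avoids n \<pi> \<longleftrightarrow> \<not> (\<exists>p q i c. 1 \<le> p \<and> p < i \<and> 1 \<le> q \<and> q < i \<and> i < c \<and> c \<le> n \<and>
     \<pi> i < \<pi> q \<and> \<pi> q < \<pi> c \<and> \<pi> c < \<pi> p)"

lemma contains_pattern_4:
  assumes "length l = 4"
  shows "contains_pattern n w l \<longleftrightarrow>
     (\<exists>a b c d. 1 \<le> a \<and> a < b \<and> b < c \<and> c < d \<and> d \<le> n \<and>
       (\<forall>r<4. \<forall>s<4. w ([a,b,c,d] ! r) < w ([a,b,c,d] ! s) \<longleftrightarrow> l ! r < l ! s))"
proof
  assume "contains_pattern n w l"
  then obtain f where f: "f \<in> {..<4} \<rightarrow> {1..n}" "strict_mono_on {..<4} f"
    "\<forall>r<4. \<forall>s<4. w (f r) < w (f s) \<longleftrightarrow> l ! r < l ! s"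
    unfolding contains_pattern_def assms by blast
  have "[f 0, f 1, f 2, f 3] ! r = f r" if "r < 4" for r
    using that by (auto simp: less_Suc_eq numeral_eq_Suc)
  moreover have "f 0 < f 1" "f 1 < f 2" "f 2 < f 3"
    using f(2) by (auto simp: strict_mono_on_def)
  moreover have "f 0 \<in> {1..n}" "f 3 \<in> {1..n}" using f(1) by auto
  ultimately show "\<exists>a b c d. 1 \<le> a \<and> a < b \<and> b < c \<and> c < d \<and> d \<le> n \<and>
       (\<forall>r<4. \<forall>s<4. w ([a,b,c,d] ! r) < w ([a,b,c,d] ! s) \<longleftrightarrow> l ! r < l ! s)"
    using f(3) by (intro exI[of _ "f 0"] exI[of _ "f 1"] exI[of _ "f 2"] exI[of _ "f 3"]) auto
next
  assume "\<exists>a b c d. 1 \<le> a \<and> a < b \<and> b < c \<and> c < d \<and> d \<le> n \<and>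
       (\<forall>r<4. \<forall>s<4. w ([a,b,c,d] ! r) < w ([a,b,c,d] ! s) \<longleftrightarrow> l ! r < l ! s)"
  then obtain a b c d where *: "1 \<le> a" "a < b" "b < c" "c < d" "d \<le> n"
    "\<forall>r<4. \<forall>s<4. w ([a,b,c,d] ! r) < w ([a,b,c,d] ! s) \<longleftrightarrow> l ! r < l ! s" by blast
  have 4: "{..<4} = {0, 1, 2, 3 :: nat}" by auto
  show "contains_pattern n w l"
    unfolding contains_pattern_def assms
    by (intro exI[of _ "\<lambda>r. [a,b,c,d] ! r"] conjI)
      (use * in \<open>auto simp: strict_mono_on_def 4\<close>)
qed

lemma avoids_iff:
  "avoids n \<pi> \<longleftrightarrow> \<not> contains_pattern n \<pi> [2,4,1,3] \<and> \<not> contains_pattern n \<pi> [4,2,1,3]"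
proof -
  have 4: "(\<forall>r<4. P r) \<longleftrightarrow> P 0 \<and> P 1 \<and> P 2 \<and> P (3::nat)" for P
    by (auto simp: numeral_eq_Suc All_less_Suc2)
  have iff1: "(\<forall>r<4. \<forall>s<4. \<pi> ([a,b,c,d] ! r) < \<pi> ([a,b,c,d] ! s) \<longleftrightarrow> [2,4,1,3::nat] ! r < [2,4,1,3] ! s)
      \<longleftrightarrow> \<pi> c < \<pi> a \<and> \<pi> a < \<pi> d \<and> \<pi> d < \<pi> b" for a b c d
    unfolding 4 by simp linarith
  have iff2: "(\<forall>r<4. \<forall>s<4. \<pi> ([a,b,c,d] ! r) < \<pi> ([a,b,c,d] ! s) \<longleftrightarrow> [4,2,1,3::nat] ! r < [4,2,1,3] ! s)
      \<longleftrightarrow> \<pi> c < \<pi> b \<and> \<pi> b < \<pi> d \<and> \<pi> d < \<pi> a" for a b c d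
    unfolding 4 by simp linarith
  have 1: "contains_pattern n \<pi> [2,4,1,3] \<longleftrightarrow> (\<exists>a b c d. 1 \<le> a \<and> a < b \<and> b < c \<and> c < d \<and> d \<le> n \<and>
      \<pi> c < \<pi> a \<and> \<pi> a < \<pi> d \<and> \<pi> d < \<pi> b)"
    by (subst contains_pattern_4) (simp, simp only: iff1)
  have 2: "contains_pattern n \<pi> [4,2,1,3] \<longleftrightarrow> (\<exists>a b c d. 1 \<le> a \<and> a < b \<and> b < c \<and> c < d \<and> d \<le> n \<and>
      \<pi> c < \<pi> b \<and> \<pi> b < \<pi> d \<and> \<pi> d < \<pi> a)"
    by (subst contains_pattern_4) (simp, simp only: iff2)
  show ?thesis unfolding 1 2 avoids_def
  proof (rule iffI, goal_cases)
    case 1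
    have "1 \<le> b" if "1 \<le> a" "a < b" for a b :: nat using that by simp
    then show ?case using 1 by (meson less_trans)
  next
    case 2
    show ?case
    proof safe
      fix p q i c
      assume h: "1 \<le> p" "p < i" "1 \<le> q" "q < i" "i < c" "c \<le> n"
        "\<pi> i < \<pi> q" "\<pi> q < \<pi> c" "\<pi> c < \<pi> p"
      have "p \<noteq> q" using h by auto
      then consider "p < q" | "q < p" by linarith
      then show False using 2 h by cases blast+
    qed
  qed
qed

lemma perms_2413_4213_eq: "perms_2413_4213 n = {\<pi>. \<pi> permutes {1..n} \<and> avoids n \<pi>}"
  by (auto simp: perms_2413_4213_def avoids_iff)

locale avoider =
  fixes n :: nat and \<pi> :: "nat \<Rightarrow> nat"
  assumes perm: "\<pi> permutes {1..n}" and avoid: "avoids n \<pi>"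
begin

lemma av: "1 \<le> p \<Longrightarrow> p < i \<Longrightarrow> 1 \<le> q \<Longrightarrow> q < i \<Longrightarrow> i < c \<Longrightarrow> c \<le> n \<Longrightarrow>
    \<pi> i < \<pi> q \<Longrightarrow> \<pi> q < \<pi> c \<Longrightarrow> \<pi> c < \<pi> p \<Longrightarrow> False"
  using avoid unfolding avoids_def by blast

lemma eq_iff: "\<pi> p = \<pi> q \<longleftrightarrow> p = q"
  using permutes_inj[OF perm] by (auto dest: injD)

lemma neq: "p \<noteq> q \<Longrightarrow> \<pi> p < \<pi> q \<or> \<pi> q < \<pi> p"
  using eq_iff by (metis linorder_neqE_nat)

text \<open>A site is closed only by an entry below some earlier one, so a new maximum closes none
  and opens the one below itself.\<close>

lemma open_pos_lma:
  assumes l: "is_lma \<pi> (Suc k)"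
  shows "open_pos \<pi> (Suc k) = insert (Suc k) (open_pos \<pi> k)"
proof (intro set_eqI iffI)
  fix p assume "p \<in> open_pos \<pi> (Suc k)"
  then show "p \<in> insert (Suc k) (open_pos \<pi> k)"
    using open_pos_bounds[of p \<pi> "Suc k"] open_pos_mono[of p \<pi> "Suc k" k] by (cases "p = Suc k") auto
next
  fix p assume p: "p \<in> insert (Suc k) (open_pos \<pi> k)"
  show "p \<in> open_pos \<pi> (Suc k)"
  proof (cases "p = Suc k")
    case True
    then show ?thesis by (simp add: open_pos_self)
  next
    case False
    then have p: "p \<in> open_pos \<pi> k" using p by simp
    show ?thesis
    proof (rule open_posI)
      fix i q assume i: "p < i" "i \<le> Suc k" "1 \<le> q" "q < i" "\<pi> i < \<pi> q" "\<pi> q < \<pi> p"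
      have "i \<noteq> Suc k"
      proof
        assume "i = Suc k"
        then have "\<pi> q < \<pi> i" using l i by (auto simp: is_lma_def)
        then show False using i by simp
      qed
      then show False using open_posD[OF p i(1) _ i(3-6)] i by simp
    qed (use open_pos_bounds[OF p] in auto)
  qed
qed

lemma ex_next_larger: "\<not> is_lma \<pi> i \<Longrightarrow> \<exists>x. next_larger \<pi> i x"
proof -
  assume l: "\<not> is_lma \<pi> i"
  define S where "S = {p \<in> {1..<i}. \<pi> i < \<pi> p}"
  obtain j where j: "j \<in> {1..<i}" "\<not> \<pi> j < \<pi> i" using l unfolding is_lma_def by auto
  then have "j \<in> S" using neq[of j i] by (auto simp: S_def)
  then have S: "finite S" "S \<noteq> {}" by (auto simp: S_def)
  obtain x where x: "x \<in> S" "\<And>p. p \<in> S \<Longrightarrow> \<pi> x \<le> \<pi> p"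
    using arg_min_if_finite[OF S, of \<pi>] by (meson not_less)
  have "next_larger \<pi> i x" unfolding next_larger_def
  proof (intro conjI allI impI)
    show "1 \<le> x" "x < i" "\<pi> i < \<pi> x" using x(1) by (auto simp: S_def)
    show "\<pi> x \<le> \<pi> p" if "1 \<le> p" "p < i" "\<pi> i < \<pi> p" for p
      using x(2)[of p] that by (auto simp: S_def)
  qed
  then show ?thesis by blast
qed

text \<open>If \<open>m\<close> and \<open>q\<close> closed the site of \<open>x\<close>, then
  \<open>q\<close>, being below \<open>x\<close>, would also be below \<open>i\<close>, and
  \<open>x\<close>, \<open>q\<close>, \<open>m\<close>, \<open>i\<close> would form a forbidden
  pattern.\<close>

lemma next_larger_open:
  assumes "next_larger \<pi> i x" "i \<le> n"
  shows "x \<in> open_pos \<pi> (i - 1)"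
proof (rule open_posI)
  note x = next_largerD[OF assms(1)]
  show "1 \<le> x" "x \<le> i - 1" using x by auto
  fix m q assume mq: "x < m" "m \<le> i - 1" "1 \<le> q" "q < m" "\<pi> m < \<pi> q" "\<pi> q < \<pi> x"
  have qi: "q < i" "m < i" using mq x by linarith+
  have "\<not> \<pi> i < \<pi> q" using x(4)[of q] mq qi by auto
  then have "\<pi> q < \<pi> i" using neq[of q i] qi by auto
  then show False using av[of x m q i] mq qi x assms by auto
qed

text \<open>The pair \<open>i\<close>, \<open>x\<close> closes every site above \<open>x\<close>.
  The sites at or below \<open>x\<close> survive because no earlier value lies between
  \<open>\<pi> i\<close> and \<open>\<pi> x\<close>.\<close>

lemma open_pos_next_larger:
  assumes "next_larger \<pi> i x" "i \<le> n"
  shows "open_pos \<pi> i = insert i {p \<in> open_pos \<pi> (i - 1). \<pi> p \<le> \<pi> x}" (is "?L = ?R")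
proof (intro set_eqI iffI)
  note x = next_largerD[OF assms(1)]
  fix p assume p: "p \<in> ?L"
  show "p \<in> ?R"
  proof (cases "p = i")
    case False
    then have pi: "1 \<le> p" "p \<le> i - 1" "p < i" using open_pos_bounds[OF p] by auto
    then have "p \<in> open_pos \<pi> (i - 1)" using open_pos_mono[OF p, of "i - 1"] by simp
    moreover have "\<pi> p \<le> \<pi> x"
      using open_posD[OF p pi(3) _ x(1-3)] by (meson not_less order_refl)
    ultimately show ?thesis by simp
  qed simp
next
  note x = next_largerD[OF assms(1)]
  fix p assume p: "p \<in> ?R"
  show "p \<in> ?L"
  proof (cases "p = i")
    case True
    then show ?thesis using x by (simp add: open_pos_self)
  next
    case False
    then have p: "p \<in> open_pos \<pi> (i - 1)" "\<pi> p \<le> \<pi> x" using p by auto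
    show ?thesis
    proof (rule open_posI)
      fix m q assume m: "p < m" "m \<le> i" "1 \<le> q" "q < m" "\<pi> m < \<pi> q" "\<pi> q < \<pi> p"
      then have "m \<noteq> i" using x(4)[of q] p(2) by auto
      then have "m \<le> i - 1" using m(2) by linarith
      then show False using open_posD[OF p(1) m(1) _ m(3-6)] by blast
    qed (use open_pos_bounds[OF p(1)] in auto)
  qed
qed

lemma not_lma_next_larger: "next_larger \<pi> i x \<Longrightarrow> \<not> is_lma \<pi> i"
  unfolding next_larger_def is_lma_def by (meson atLeastLessThan_iff less_asym)

lemma code_next_larger:
  assumes "next_larger \<pi> i x" "i \<le> n"
  shows "code \<pi> i = card {p \<in> open_pos \<pi> (i - 1). \<pi> p \<le> \<pi> x}"
proof -
  note x = next_largerD[OF assms(1)]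
  have "{p \<in> open_pos \<pi> (i - 1). \<pi> p \<le> \<pi> x} = insert x {p \<in> open_pos \<pi> (i - 1). \<pi> p < \<pi> i}"
  proof (intro set_eqI iffI)
    fix p assume p: "p \<in> {p \<in> open_pos \<pi> (i - 1). \<pi> p \<le> \<pi> x}"
    then have "1 \<le> p" "p < i" using open_pos_bounds[of p \<pi> "i - 1"] x by auto
    then show "p \<in> insert x {p \<in> open_pos \<pi> (i - 1). \<pi> p < \<pi> i}"
      using p x(4)[of p] neq[of p i] eq_iff[of p x] by auto
  next
    fix p assume "p \<in> insert x {p \<in> open_pos \<pi> (i - 1). \<pi> p < \<pi> i}"
    then show "p \<in> {p \<in> open_pos \<pi> (i - 1). \<pi> p \<le> \<pi> x}"
      using next_larger_open[OF assms] x(3) by auto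
  qed
  then show ?thesis using not_lma_next_larger[OF assms(1)] x(3) by (simp add: code_def)
qed

lemma code_eq_0: "code \<pi> i = 0 \<longleftrightarrow> is_lma \<pi> i"
  by (simp add: code_def)

lemma card_open_pos_non_lma:
  assumes "\<not> is_lma \<pi> i" "i \<le> n"
  shows "card (open_pos \<pi> i) = Suc (code \<pi> i)" "code \<pi> i \<le> card (open_pos \<pi> (i - 1))"
proof -
  obtain x where x: "next_larger \<pi> i x" using ex_next_larger[OF assms(1)] by blast
  have "i \<notin> open_pos \<pi> (i - 1)"
    using open_pos_bounds[of i \<pi> "i - 1"] next_largerD(1,2)[OF x] by auto
  then show "card (open_pos \<pi> i) = Suc (code \<pi> i)"
    unfolding open_pos_next_larger[OF x assms(2)] code_next_larger[OF x assms(2)] by simp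
  show "code \<pi> i \<le> card (open_pos \<pi> (i - 1))"
    unfolding code_next_larger[OF x assms(2)] by (auto intro: card_mono)
qed

text \<open>The height counts the open positions: a new maximum adds one, and an entry with code
  \<open>x\<close> keeps the lowest \<open>x\<close> of them and adds itself.\<close>

lemma valid_codes: "k \<le> n \<Longrightarrow> valid 0 (codes k \<pi>) \<and> hgt 0 (codes k \<pi>) = card (open_pos \<pi> k)"
proof (induction k)
  case 0
  then show ?case by (simp add: codes_def open_pos_def)
next
  case (Suc k)
  have ni: "Suc k \<notin> open_pos \<pi> k" using open_pos_subset[of \<pi> k] by auto
  show ?case
  proof (cases "is_lma \<pi> (Suc k)")
    case True
    then show ?thesis using Suc open_pos_lma[OF True] ni
      by (simp add: codes_Suc valid_append hgt_append code_def)
  next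
    case False
    then show ?thesis using Suc card_open_pos_non_lma[OF False] code_eq_0[of "Suc k"]
      by (simp add: codes_Suc valid_append hgt_append)
  qed
qed

end

lemma reuse_codes:
  assumes "0 < k"
  shows "reuse k (drop i (codes n \<pi>)) \<longleftrightarrow>
    (\<exists>c. i < c \<and> c \<le> n \<and> code \<pi> c = k \<and> (\<forall>m. i < m \<longrightarrow> m < c \<longrightarrow> code \<pi> m = 0 \<or> k < code \<pi> m))"
    (is "?L \<longleftrightarrow> ?R")
proof -
  have "?L \<longleftrightarrow> (\<exists>p<n - i. (\<forall>m<p. drop i (codes n \<pi>) ! m = 0 \<or> k < drop i (codes n \<pi>) ! m) \<and>
      drop i (codes n \<pi>) ! p = k)"
    using reuse_iff[OF assms] by simp
  also have "\<dots> \<longleftrightarrow> (\<exists>p<n - i. (\<forall>m<p. code \<pi> (Suc (i + m)) = 0 \<or> k < code \<pi> (Suc (i + m))) \<and>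
      code \<pi> (Suc (i + p)) = k)"
    by (intro ex_cong1 conj_cong refl all_cong) (simp_all add: codes_nth)
  also have "\<dots> \<longleftrightarrow> ?R"
  proof
    assume "\<exists>p<n - i. (\<forall>m<p. code \<pi> (Suc (i + m)) = 0 \<or> k < code \<pi> (Suc (i + m))) \<and> code \<pi> (Suc (i + p)) = k"
    then obtain p where p: "p < n - i" "\<And>m. m < p \<Longrightarrow> code \<pi> (Suc (i + m)) = 0 \<or> k < code \<pi> (Suc (i + m))"
      "code \<pi> (Suc (i + p)) = k" by blast
    have "code \<pi> m = 0 \<or> k < code \<pi> m" if "i < m" "m < Suc (i + p)" for m
      using p(2)[of "m - Suc i"] that by simp
    then show ?R using p by (intro exI[of _ "Suc (i + p)"]) simp
  next
    assume ?R
    then obtain c where c: "i < c" "c \<le> n" "code \<pi> c = k"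
      "\<And>m. i < m \<Longrightarrow> m < c \<Longrightarrow> code \<pi> m = 0 \<or> k < code \<pi> m" by blast
    then show "\<exists>p<n - i. (\<forall>m<p. code \<pi> (Suc (i + m)) = 0 \<or> k < code \<pi> (Suc (i + m))) \<and> code \<pi> (Suc (i + p)) = k"
      by (intro exI[of _ "c - Suc i"]) auto
  qed
  finally show ?thesis .
qed

lemma above_codes: "above k (drop i (codes n \<pi>)) \<longleftrightarrow> (\<forall>c. i < c \<longrightarrow> c \<le> n \<longrightarrow> code \<pi> c = 0 \<or> k < code \<pi> c)"
proof -
  have "set (drop i (codes n \<pi>)) = code \<pi> ` {i<..n}"
    by (auto simp: codes_def drop_map drop_upt simp del: upt_Suc)
  then show ?thesis by auto
qed

section \<open>Statistics of a permutation read from its code\<close>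

context avoider
begin

lemma code_non_lma:
  "\<not> is_lma \<pi> c \<Longrightarrow> code \<pi> c = Suc (card {p \<in> open_pos \<pi> (c - 1). \<pi> p < \<pi> c})"
  by (simp add: code_def)

text \<open>After step \<open>i\<close> the site of \<open>x\<close> has number
  \<open>Suc (code \<pi> i)\<close>. Larger codes select sites above \<open>x\<close> and zeros are
  new maxima, so neither touches the stack up to \<open>x\<close>.\<close>

lemma low_part_stable:
  assumes x: "next_larger \<pi> i x" and i: "i \<le> n"
  shows "i \<le> k \<Longrightarrow> k \<le> n \<Longrightarrow> (\<And>m. i < m \<Longrightarrow> m \<le> k \<Longrightarrow> code \<pi> m = 0 \<or> Suc (code \<pi> i) < code \<pi> m) \<Longrightarrow>
    {p \<in> open_pos \<pi> k. \<pi> p \<le> \<pi> x} = open_pos \<pi> i \<and> (\<forall>p. 1 \<le> p \<longrightarrow> p \<le> k \<longrightarrow> \<not> (\<pi> i < \<pi> p \<and> \<pi> p < \<pi> x))"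
proof (induction k rule: dec_induct)
  case base
  note x' = next_largerD[OF x]
  have "\<not> (\<pi> i < \<pi> p \<and> \<pi> p < \<pi> x)" if "1 \<le> p" "p \<le> i" for p
    using x'(4)[of p] that by (cases "p = i") auto
  then show ?case unfolding open_pos_next_larger[OF x i] using x'(3) by auto
next
  case (step k)
  note x' = next_largerD[OF x]
  have kn: "k \<le> n" using step.prems(1) by simp
  have "code \<pi> m = 0 \<or> Suc (code \<pi> i) < code \<pi> m" if "i < m" "m \<le> k" for m
    using step.prems(2)[of m] that by simp
  note ih = step.IH[OF kn this]
  have IH: "{p \<in> open_pos \<pi> k. \<pi> p \<le> \<pi> x} = open_pos \<pi> i"
    "\<And>p. 1 \<le> p \<Longrightarrow> p \<le> k \<Longrightarrow> \<not> (\<pi> i < \<pi> p \<and> \<pi> p < \<pi> x)"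
    using ih by blast+
  have big: "\<pi> x < \<pi> (Suc k)"
  proof (cases "is_lma \<pi> (Suc k)")
    case True
    then show ?thesis using x'(1-3) step.hyps by (auto simp: is_lma_def)
  next
    case False
    show ?thesis
    proof (rule ccontr)
      assume "\<not> ?thesis"
      then have "\<pi> (Suc k) < \<pi> x" using neq[of "Suc k" x] x'(1-3) step.hyps by auto
      \<comment> \<open>The open positions below the new entry miss \<open>x\<close>, so there are
        at most \<open>code \<pi> i\<close> of them.\<close>
      then have "{p \<in> open_pos \<pi> k. \<pi> p < \<pi> (Suc k)} \<subseteq> open_pos \<pi> i - {x}"
        unfolding IH(1)[symmetric] by auto
      then have "card {p \<in> open_pos \<pi> k. \<pi> p < \<pi> (Suc k)} \<le> card (open_pos \<pi> i - {x})"
        by (intro card_mono) auto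
      also have "\<dots> = code \<pi> i"
      proof -
        have "x \<in> open_pos \<pi> i" unfolding open_pos_next_larger[OF x i]
          using next_larger_open[OF x i] by simp
        then show ?thesis using card_open_pos_non_lma(1)[OF not_lma_next_larger[OF x] i] by simp
      qed
      finally have "code \<pi> (Suc k) \<le> Suc (code \<pi> i)" using code_non_lma[OF False] by simp
      then show False using step.prems(2)[of "Suc k"] step.hyps code_eq_0[of "Suc k"] False by auto
    qed
  qed
  have "{p \<in> open_pos \<pi> (Suc k). \<pi> p \<le> \<pi> x} = {p \<in> open_pos \<pi> k. \<pi> p \<le> \<pi> x}"
  proof (cases "is_lma \<pi> (Suc k)")
    case True
    then show ?thesis unfolding open_pos_lma[OF True] using big by auto
  next
    case False
    then obtain y where y: "next_larger \<pi> (Suc k) y" using ex_next_larger by blast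
    show ?thesis unfolding open_pos_next_larger[OF y step.prems(1)]
      using big next_largerD(3)[OF y] by auto
  qed
  moreover have "\<not> (\<pi> i < \<pi> p \<and> \<pi> p < \<pi> x)" if "1 \<le> p" "p \<le> Suc k" for p
    using IH(2)[of p] that big by (cases "p = Suc k") auto
  ultimately show ?case using IH(1) by auto
qed

text \<open>Until \<open>c\<close>, the open positions \<open>i\<close> and \<open>x\<close> keep
  the numbers \<open>code \<pi> i\<close> and \<open>Suc (code \<pi> i)\<close>. Selecting the site
  of \<open>x\<close> therefore lands between the two, selecting a lower one lands below
  \<open>\<pi> i\<close>.\<close>

lemma first_low_code:
  assumes x: "next_larger \<pi> i x" and i: "i \<le> n" and c: "i < c" "c \<le> n" "code \<pi> c \<noteq> 0"
    "code \<pi> c \<le> Suc (code \<pi> i)"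
    and m: "\<And>m. i < m \<Longrightarrow> m < c \<Longrightarrow> code \<pi> m = 0 \<or> Suc (code \<pi> i) < code \<pi> m"
  shows "if code \<pi> c = Suc (code \<pi> i) then \<pi> i < \<pi> c \<and> \<pi> c < \<pi> x else \<pi> c < \<pi> i"
proof -
  note x' = next_largerD[OF x]
  define A where "A = {p \<in> open_pos \<pi> (c - 1). \<pi> p < \<pi> c}"
  have cA: "code \<pi> c = Suc (card A)"
    using code_non_lma[of c] c(3) code_eq_0[of c] unfolding A_def by simp
  have fA: "finite A" by (simp add: A_def)
  have st: "{p \<in> open_pos \<pi> (c - 1). \<pi> p \<le> \<pi> x} = open_pos \<pi> i"
    using low_part_stable[OF x i, of "c - 1"] c m by auto
  have xo: "x \<in> open_pos \<pi> i" unfolding open_pos_next_larger[OF x i]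
    using next_larger_open[OF x i] by simp
  have io: "i \<in> open_pos \<pi> i" unfolding open_pos_next_larger[OF x i] by simp
  have card: "card (open_pos \<pi> i) = Suc (code \<pi> i)"
    by (rule card_open_pos_non_lma(1)[OF not_lma_next_larger[OF x] i])
  have cx: "\<pi> c < \<pi> x"
  proof (rule ccontr)
    assume "\<not> ?thesis"
    then have "\<pi> x < \<pi> c" using neq[of c x] x'(1-3) c by auto
    then have "open_pos \<pi> i \<subseteq> A" unfolding A_def st[symmetric] by auto
    then have "Suc (code \<pi> i) \<le> card A" using card_mono[OF fA] card by metis
    then show False using cA c(4) by simp
  qed
  show ?thesis
  proof (cases "\<pi> i < \<pi> c")
    case True
    have "open_pos \<pi> i - {x} \<subseteq> A"
    proof
      fix p assume p: "p \<in> open_pos \<pi> i - {x}"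
      then have p': "p \<in> open_pos \<pi> (c - 1)" "\<pi> p \<le> \<pi> x" "p \<noteq> x" using st by auto
      have "1 \<le> p" "p \<le> i" using p open_pos_bounds[of p] by auto
      then have "\<not> \<pi> i < \<pi> p" using x'(4)[of p] p' eq_iff[of p x] by (cases "p = i") auto
      then show "p \<in> A" using p' True by (auto simp: A_def)
    qed
    then have "code \<pi> i \<le> card A" using card_mono[OF fA, of "open_pos \<pi> i - {x}"] card xo by simp
    then show ?thesis using True cx cA c(4) by simp
  next
    case False
    then have ci: "\<pi> c < \<pi> i" using neq[of c i] c by auto
    have "A \<subseteq> open_pos \<pi> i - {i, x}" unfolding st[symmetric] using ci cx by (auto simp: A_def)
    then have "card A \<le> card (open_pos \<pi> i - {i, x})" by (intro card_mono) auto
    also have "\<dots> = Suc (code \<pi> i) - 2"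
      using card xo io x'(1-3) by (subst card_Diff_subset) auto
    also have "\<dots> < code \<pi> i"
      using not_lma_next_larger[OF x] code_eq_0[of i] by simp
    finally show ?thesis using cA ci by simp
  qed
qed

lemma reuse_iff_between:
  assumes x: "next_larger \<pi> i x" and i: "i \<le> n"
  shows "reuse (Suc (code \<pi> i)) (drop i (codes n \<pi>)) \<longleftrightarrow> (\<exists>c. i < c \<and> c \<le> n \<and> \<pi> i < \<pi> c \<and> \<pi> c < \<pi> x)"
proof
  assume "reuse (Suc (code \<pi> i)) (drop i (codes n \<pi>))"
  then obtain c where c: "i < c" "c \<le> n" "code \<pi> c = Suc (code \<pi> i)"
    "\<And>m. i < m \<Longrightarrow> m < c \<Longrightarrow> code \<pi> m = 0 \<or> Suc (code \<pi> i) < code \<pi> m"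
    unfolding reuse_codes[OF zero_less_Suc] by blast
  then show "\<exists>c. i < c \<and> c \<le> n \<and> \<pi> i < \<pi> c \<and> \<pi> c < \<pi> x"
    using first_low_code[OF x i c(1,2) _ _ c(4)] by auto
next
  assume "\<exists>c. i < c \<and> c \<le> n \<and> \<pi> i < \<pi> c \<and> \<pi> c < \<pi> x"
  then obtain b where b: "i < b" "b \<le> n" "\<pi> i < \<pi> b" "\<pi> b < \<pi> x" by blast
  note x' = next_largerD[OF x]
  define P where "P = (\<lambda>m. i < m \<and> m \<le> b \<and> code \<pi> m \<noteq> 0 \<and> code \<pi> m \<le> Suc (code \<pi> i))"
  have "\<exists>m. P m"
  proof (rule ccontr)
    assume "\<nexists>m. P m"
    then have "\<And>m. i < m \<Longrightarrow> m \<le> b \<Longrightarrow> code \<pi> m = 0 \<or> Suc (code \<pi> i) < code \<pi> m"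
      unfolding P_def by (meson not_less)
    then show False using low_part_stable[OF x i, of b] b x'(1-3) by auto
  qed
  define c where "c = (LEAST m. P m)"
  have Pc: "P c" unfolding c_def by (rule LeastI_ex) fact
  have min: "code \<pi> m = 0 \<or> Suc (code \<pi> i) < code \<pi> m" if "i < m" "m < c" for m
  proof -
    have "\<not> P m" using not_less_Least[of m P] that(2) unfolding c_def by blast
    then show ?thesis using that Pc unfolding P_def by auto
  qed
  note fc = first_low_code[OF x i, of c, OF _ _ _ _ min]
  \<comment> \<open>A smaller code would put \<open>c\<close> below \<open>\<pi> i\<close> and so
    close the site of \<open>x\<close>: \<open>x\<close>, \<open>i\<close>, \<open>c\<close>,
    \<open>b\<close> would be a forbidden pattern.\<close>
  have "code \<pi> c = Suc (code \<pi> i)"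
  proof (rule ccontr)
    assume "code \<pi> c \<noteq> Suc (code \<pi> i)"
    then have ci: "\<pi> c < \<pi> i" using fc Pc b unfolding P_def by auto
    then have "c < b" using Pc b unfolding P_def by (cases "c = b") auto
    then show False using av[of x c i b] x'(1-3) Pc ci b unfolding P_def by auto
  qed
  then show "reuse (Suc (code \<pi> i)) (drop i (codes n \<pi>))"
    unfolding reuse_codes[OF zero_less_Suc] using Pc b min unfolding P_def by (intro exI[of _ c]) auto
qed

lemma vid_not_lma: "i \<in> VID n \<pi> \<Longrightarrow> \<not> is_lma \<pi> i"
  by (force simp: VID_def is_lma_def)

lemma vid_iff_next_larger:
  assumes x: "next_larger \<pi> i x" and i: "i \<le> n"
  shows "i \<in> VID n \<pi> \<longleftrightarrow> \<pi> x = Suc (\<pi> i)"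
proof
  note x' = next_largerD[OF x]
  assume "i \<in> VID n \<pi>"
  then obtain j where "1 \<le> j" "j < i" "\<pi> j = Suc (\<pi> i)" by (auto simp: VID_def)
  then show "\<pi> x = Suc (\<pi> i)" using x'(4)[of j] x'(3) by simp
next
  note x' = next_largerD[OF x]
  assume "\<pi> x = Suc (\<pi> i)"
  then have "x \<in> {1..<i}" "\<pi> x = \<pi> i + 1" "i \<in> {2..n}" using x'(1-3) i by auto
  then show "i \<in> VID n \<pi>" unfolding VID_def by blast
qed

text \<open>If \<open>\<pi> x\<close> exceeds \<open>\<pi> i + 1\<close>, that value is attained
  after \<open>i\<close> and lies between the two.\<close>

lemma vid_iff_between:
  assumes x: "next_larger \<pi> i x" and i: "i \<le> n"
  shows "i \<in> VID n \<pi> \<longleftrightarrow> \<not> (\<exists>c. i < c \<and> c \<le> n \<and> \<pi> i < \<pi> c \<and> \<pi> c < \<pi> x)"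
proof -
  note x' = next_largerD[OF x]
  have "\<exists>c. i < c \<and> c \<le> n \<and> \<pi> i < \<pi> c \<and> \<pi> c < \<pi> x" if "\<pi> x \<noteq> Suc (\<pi> i)"
  proof -
    have "x \<in> {1..n}" using x'(1,2) i by simp
    then have "\<pi> x \<in> {1..n}" using permutes_in_image[OF perm] by blast
    then have "Suc (\<pi> i) \<in> {1..n}" using x'(3) by auto
    then have "Suc (\<pi> i) \<in> \<pi> ` {1..n}" using permutes_image[OF perm] by blast
    then obtain c where c: "c \<in> {1..n}" "\<pi> c = Suc (\<pi> i)" by (metis imageE)
    have "i < c"
    proof (rule ccontr)
      assume "\<not> i < c"
      then have "c < i" using c(2) by (cases "c = i") auto
      then show False using x'(3) x'(4)[of c] c that by auto
    qed
    then show ?thesis using c x'(3) that by auto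
  qed
  then show ?thesis using vid_iff_next_larger[OF assms] by auto
qed

lemma vid_iff_flag:
  assumes "i < n"
  shows "Suc i \<in> VID n \<pi> \<longleftrightarrow> vid_flags (codes n \<pi>) ! i"
proof (cases "is_lma \<pi> (Suc i)")
  case True
  then show ?thesis using assms vid_not_lma code_eq_0 by (auto simp: vid_flags_nth codes_nth)
next
  case False
  then obtain x where x: "next_larger \<pi> (Suc i) x" using ex_next_larger by blast
  show ?thesis
    using vid_iff_between[OF x] reuse_iff_between[OF x] assms False code_eq_0
    by (auto simp: vid_flags_nth codes_nth)
qed

lemma lma_iff_flag: "i < n \<Longrightarrow> Suc i \<in> LMA n \<pi> \<longleftrightarrow> codes n \<pi> ! i = 0"
  using code_eq_0 by (auto simp: LMA_def is_lma_def codes_nth)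

text \<open>Position 1 is a minimum although its code is 0, whence the separate disjunct. Elsewhere
  the position \<open>m\<close> of the smallest earlier value is always open, so it decides whether
  any open position lies below the new entry.\<close>

lemma lmi_iff_flag:
  assumes "i < n"
  shows "Suc i \<in> LMI n \<pi> \<longleftrightarrow> i = 0 \<or> codes n \<pi> ! i = 1"
proof (cases "i = 0")
  case True
  then show ?thesis using assms by (auto simp: LMI_def)
next
  case False
  have "finite {1..i}" "{1..i} \<noteq> {}" using False by auto
  from arg_min_if_finite[OF this, of \<pi>] obtain m where m: "m \<in> {1..i}" "\<And>p. p \<in> {1..i} \<Longrightarrow> \<pi> m \<le> \<pi> p"
    by (meson not_less)
  have mo: "m \<in> open_pos \<pi> i"
  proof (rule open_posI)
    fix j q assume "m < j" "j \<le> i" "1 \<le> q" "q < j" "\<pi> j < \<pi> q" "\<pi> q < \<pi> m"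
    then show False using m(2)[of q] by auto
  qed (use m in auto)
  show ?thesis
  proof
    assume L: "Suc i \<in> LMI n \<pi>"
    then have less: "\<pi> (Suc i) < \<pi> p" if "1 \<le> p" "p \<le> i" for p using that by (auto simp: LMI_def)
    have "m \<in> {1..<Suc i}" "\<not> \<pi> m < \<pi> (Suc i)" using m(1) less[of m] by auto
    then have "\<not> is_lma \<pi> (Suc i)" unfolding is_lma_def by blast
    moreover have "{p \<in> open_pos \<pi> i. \<pi> p < \<pi> (Suc i)} = {}"
      using less open_pos_bounds[of _ \<pi> i] less_asym by blast
    ultimately show "i = 0 \<or> codes n \<pi> ! i = 1" using assms by (simp add: codes_nth code_def)
  next
    assume "i = 0 \<or> codes n \<pi> ! i = 1"
    then have "code \<pi> (Suc i) = 1" using False assms by (simp add: codes_nth)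
    then have "{p \<in> open_pos \<pi> i. \<pi> p < \<pi> (Suc i)} = {}"
      by (auto simp: code_def split: if_splits)
    then have "\<not> \<pi> m < \<pi> (Suc i)" using mo by auto
    then have "\<pi> (Suc i) < \<pi> m" using neq[of "Suc i" m] m(1) by auto
    then have "\<pi> (Suc i) < \<pi> p" if "p \<in> {1..i}" for p using m(2)[OF that] by simp
    then show "Suc i \<in> LMI n \<pi>" using assms by (auto simp: LMI_def)
  qed
qed

lemma lower_part_stable:
  assumes i: "1 \<le> i"
  shows "i \<le> k \<Longrightarrow> k \<le> n \<Longrightarrow> (\<And>c. i < c \<Longrightarrow> c \<le> k \<Longrightarrow> \<pi> i < \<pi> c) \<Longrightarrow>
    {p \<in> open_pos \<pi> k. \<pi> p \<le> \<pi> i} = {p \<in> open_pos \<pi> i. \<pi> p \<le> \<pi> i}"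
proof (induction k rule: dec_induct)
  case base
  then show ?case by simp
next
  case (step k)
  have big: "\<pi> i < \<pi> (Suc k)" by (rule step.prems(2)) (use step.hyps in auto)
  have IH: "{p \<in> open_pos \<pi> k. \<pi> p \<le> \<pi> i} = {p \<in> open_pos \<pi> i. \<pi> p \<le> \<pi> i}"
    by (rule step.IH) (use step.prems(1) in simp, rule step.prems(2), auto)
  have "{p \<in> open_pos \<pi> (Suc k). \<pi> p \<le> \<pi> i} = {p \<in> open_pos \<pi> k. \<pi> p \<le> \<pi> i}"
  proof (cases "is_lma \<pi> (Suc k)")
    case True
    then show ?thesis unfolding open_pos_lma[OF True] using big by auto
  next
    case False
    then obtain y where y: "next_larger \<pi> (Suc k) y" using ex_next_larger by blast
    show ?thesis unfolding open_pos_next_larger[OF y step.prems(1)]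
      using big next_largerD(3)[OF y] by auto
  qed
  then show ?case using IH by simp
qed

text \<open>Right after step \<open>i\<close>, a new maximum has every open position at or below it;
  otherwise only \<open>x\<close> is above.\<close>

lemma card_lower_part:
  assumes "1 \<le> i" "i \<le> n"
  shows "card {p \<in> open_pos \<pi> i. \<pi> p \<le> \<pi> i} = (if is_lma \<pi> i then card (open_pos \<pi> i) else code \<pi> i)"
proof (cases "is_lma \<pi> i")
  case True
  have "\<pi> p \<le> \<pi> i" if "p \<in> open_pos \<pi> i" for p
    using open_pos_bounds[OF that] True by (cases "p = i") (auto simp: is_lma_def less_imp_le)
  then have "{p \<in> open_pos \<pi> i. \<pi> p \<le> \<pi> i} = open_pos \<pi> i" by auto
  then show ?thesis using True by simp
next
  case False
  then obtain x where x: "next_larger \<pi> i x" using ex_next_larger by blast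
  note x' = next_largerD[OF x]
  have xo: "x \<in> open_pos \<pi> i" unfolding open_pos_next_larger[OF x assms(2)]
    using next_larger_open[OF x assms(2)] by simp
  have "{p \<in> open_pos \<pi> i. \<pi> p \<le> \<pi> i} = open_pos \<pi> i - {x}"
  proof (intro set_eqI iffI)
    fix p assume p: "p \<in> open_pos \<pi> i - {x}"
    then have pb: "1 \<le> p" "p \<le> i" using open_pos_bounds[of p] by auto
    have "p = i \<or> \<pi> p < \<pi> x" using p eq_iff[of p x] unfolding open_pos_next_larger[OF x assms(2)] by auto
    then have "\<not> \<pi> i < \<pi> p" using x'(4)[of p] pb by (cases "p = i") auto
    then show "p \<in> {p \<in> open_pos \<pi> i. \<pi> p \<le> \<pi> i}" using p by auto
  qed (use x'(3) in auto)
  then show ?thesis using False xo card_open_pos_non_lma(1)[OF False assms(2)] by simp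
qed

text \<open>The open positions at or below \<open>\<pi> i\<close> stay fixed while only larger
  entries arrive. An entry above \<open>\<pi> i\<close> then has all of them below it, whereas the
  first smaller entry misses at least \<open>i\<close>.\<close>

lemma all_larger_iff:
  assumes "1 \<le> i" "i \<le> n"
  shows "(\<forall>c. i < c \<longrightarrow> c \<le> n \<longrightarrow> \<pi> i < \<pi> c) \<longleftrightarrow>
    (\<forall>c. i < c \<longrightarrow> c \<le> n \<longrightarrow> code \<pi> c = 0 \<or> card {p \<in> open_pos \<pi> i. \<pi> p \<le> \<pi> i} < code \<pi> c)"
    (is "?L \<longleftrightarrow> ?R")
proof
  let ?G = "{p \<in> open_pos \<pi> i. \<pi> p \<le> \<pi> i}"
  assume L: ?L
  show ?R
  proof (intro allI impI)
    fix c assume c: "i < c" "c \<le> n"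
    show "code \<pi> c = 0 \<or> card ?G < code \<pi> c"
    proof (cases "is_lma \<pi> c")
      case True
      then show ?thesis using code_eq_0 by simp
    next
      case False
      have st: "{p \<in> open_pos \<pi> (c - 1). \<pi> p \<le> \<pi> i} = ?G"
        by (rule lower_part_stable) (use assms c L in auto)
      have "\<pi> i < \<pi> c" using L c by blast
      then have "?G \<subseteq> {p \<in> open_pos \<pi> (c - 1). \<pi> p < \<pi> c}" unfolding st[symmetric] by auto
      then have "card ?G \<le> card {p \<in> open_pos \<pi> (c - 1). \<pi> p < \<pi> c}" by (intro card_mono) auto
      then show ?thesis using code_non_lma[OF False] by simp
    qed
  qed
next
  let ?G = "{p \<in> open_pos \<pi> i. \<pi> p \<le> \<pi> i}"
  assume R: ?R
  show ?L
  proof (rule ccontr)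
    define P where "P = (\<lambda>c. i < c \<and> c \<le> n \<and> \<not> \<pi> i < \<pi> c)"
    assume "\<not> ?L"
    then have ex: "\<exists>c. P c" unfolding P_def by auto
    define c where "c = (LEAST c. P c)"
    have Pc: "P c" unfolding c_def by (rule LeastI_ex) fact
    have min: "\<pi> i < \<pi> m" if "i < m" "m \<le> c - 1" for m
    proof -
      have "m < c" using that by linarith
      then have "\<not> P m" using not_less_Least[of m P] unfolding c_def by blast
      then show ?thesis using that Pc unfolding P_def by auto
    qed
    have ci: "\<pi> c < \<pi> i" using neq[of c i] Pc unfolding P_def by auto
    have nl: "\<not> is_lma \<pi> c" using ci Pc assms unfolding is_lma_def P_def by force
    have st: "{p \<in> open_pos \<pi> (c - 1). \<pi> p \<le> \<pi> i} = ?G"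
      by (rule lower_part_stable) (use assms Pc min in \<open>auto simp: P_def\<close>)
    have "{p \<in> open_pos \<pi> (c - 1). \<pi> p < \<pi> c} \<subseteq> ?G - {i}" unfolding st[symmetric] using ci by auto
    then have "card {p \<in> open_pos \<pi> (c - 1). \<pi> p < \<pi> c} \<le> card (?G - {i})" by (intro card_mono) auto
    also have "\<dots> < card ?G" by (rule card_Diff1_less) (use assms in \<open>auto simp: open_pos_self\<close>)
    finally have "code \<pi> c \<le> card ?G" using code_non_lma[OF nl] by simp
    then show False using R Pc nl code_eq_0[of c] unfolding P_def by force
  qed
qed

lemma take_codes: "k \<le> n \<Longrightarrow> take k (codes n \<pi>) = codes k \<pi>"
  by (simp add: codes_def take_map take_upt del: upt_Suc)

lemma rmi_iff_flag:
  assumes "i < n"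
  shows "Suc i \<in> RMI n \<pi> \<longleftrightarrow> rmi_flags 0 (codes n \<pi>) ! i"
proof -
  have "Suc i \<in> RMI n \<pi> \<longleftrightarrow> (\<forall>c. Suc i < c \<longrightarrow> c \<le> n \<longrightarrow> \<pi> (Suc i) < \<pi> c)"
    using assms by (auto simp: RMI_def)
  also have "\<dots> \<longleftrightarrow> above (if is_lma \<pi> (Suc i) then card (open_pos \<pi> (Suc i)) else code \<pi> (Suc i)) (drop (Suc i) (codes n \<pi>))"
    using all_larger_iff[of "Suc i"] card_lower_part[of "Suc i"] assms by (simp add: above_codes)
  also have "\<dots> \<longleftrightarrow> rmi_flags 0 (codes n \<pi>) ! i"
    using assms code_eq_0[of "Suc i"] valid_codes[of "Suc i"]
    by (simp add: rmi_flags_nth codes_nth take_codes)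
  finally show ?thesis .
qed

end

section \<open>Right-to-left maxima and descents\<close>

lemma not_lmaI: "1 \<le> p \<Longrightarrow> p < i \<Longrightarrow> \<pi> i < \<pi> p \<Longrightarrow> \<not> is_lma \<pi> i"
  unfolding is_lma_def by (meson atLeastLessThan_iff less_asym)

context avoider
begin

lemma lma_iff: "1 \<le> i \<Longrightarrow> i \<le> n \<Longrightarrow> i \<in> LMA n \<pi> \<longleftrightarrow> is_lma \<pi> i"
  by (simp add: LMA_def is_lma_def)

lemma max_position:
  assumes "1 \<le> n"
  obtains M where "1 \<le> M" "M \<le> n" "is_lma \<pi> M" "\<And>p. 1 \<le> p \<Longrightarrow> p \<le> n \<Longrightarrow> p \<noteq> M \<Longrightarrow> \<pi> p < \<pi> M"
proof -
  have "n \<in> \<pi> ` {1..n}" using permutes_image[OF perm] assms by simp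
  then obtain M where M: "M \<in> {1..n}" "\<pi> M = n" by (metis imageE)
  have *: "\<pi> p < \<pi> M" if "1 \<le> p" "p \<le> n" "p \<noteq> M" for p
  proof -
    have "p \<in> {1..n}" using that by simp
    then have "\<pi> p \<in> {1..n}" using permutes_in_image[OF perm] by blast
    then show ?thesis using M(2) eq_iff[of p M] that by (simp add: order_less_le)
  qed
  have "is_lma \<pi> M" unfolding is_lma_def
  proof
    fix j assume "j \<in> {1..<M}"
    then show "\<pi> j < \<pi> M" using *[of j] M(1) by simp
  qed
  then show ?thesis using that[of M] * M(1) by simp
qed

text \<open>No later new maximum means that the largest value occurs by position \<open>i\<close>.
  If also \<open>\<pi> x = \<pi> i + 1\<close>, a later entry above \<open>\<pi> i\<close> would lie
  above \<open>\<pi> x\<close> too and complete a forbidden pattern with the largest value,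
  \<open>x\<close> and \<open>i\<close>.\<close>

lemma rma_iff:
  assumes i: "1 \<le> i" "i \<le> n"
  shows "i \<in> RMA n \<pi> \<longleftrightarrow> (\<forall>c\<in>{i<..n}. c \<notin> LMA n \<pi>) \<and> (i \<in> LMA n \<pi> \<or> i \<in> VID n \<pi>)"
proof
  assume r: "i \<in> RMA n \<pi>"
  then have less: "\<pi> c < \<pi> i" if "i < c" "c \<le> n" for c using that by (simp add: RMA_def)
  have "c \<notin> LMA n \<pi>" if "c \<in> {i<..n}" for c
    using not_lmaI[of i c \<pi>] less[of c] lma_iff[of c] that i by simp
  moreover have "i \<in> VID n \<pi>" if nl: "i \<notin> LMA n \<pi>"
  proof -
    obtain x where x: "next_larger \<pi> i x" using nl lma_iff[OF i] ex_next_larger by blast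
    show ?thesis using vid_iff_between[OF x i(2)] less less_asym by blast
  qed
  ultimately show "(\<forall>c\<in>{i<..n}. c \<notin> LMA n \<pi>) \<and> (i \<in> LMA n \<pi> \<or> i \<in> VID n \<pi>)" by blast
next
  assume h: "(\<forall>c\<in>{i<..n}. c \<notin> LMA n \<pi>) \<and> (i \<in> LMA n \<pi> \<or> i \<in> VID n \<pi>)"
  have "1 \<le> n" using i by simp
  then obtain M where M: "1 \<le> M" "M \<le> n" "is_lma \<pi> M" "\<And>p. 1 \<le> p \<Longrightarrow> p \<le> n \<Longrightarrow> p \<noteq> M \<Longrightarrow> \<pi> p < \<pi> M"
    using max_position by blast
  have Mi: "M \<le> i"
  proof (rule ccontr)
    assume "\<not> M \<le> i"
    then show False using h M(1-3) lma_iff[of M] by auto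
  qed
  have "\<pi> c < \<pi> i" if c: "i < c" "c \<le> n" for c
  proof (cases "M = i")
    case True
    then show ?thesis using M(4)[of c] c by simp
  next
    case False
    then have "M < i" "\<pi> i < \<pi> M" using Mi M(4)[of i] i by auto
    then have nl: "\<not> is_lma \<pi> i" using M(1) not_lmaI by blast
    then obtain x where x: "next_larger \<pi> i x" using ex_next_larger by blast
    have v: "\<pi> x = Suc (\<pi> i)" using vid_iff_next_larger[OF x i(2)] h nl lma_iff[OF i] by blast
    show ?thesis
    proof (rule ccontr)
      assume "\<not> ?thesis"
      then have "\<pi> i < \<pi> c" using neq[of i c] c by auto
      moreover have "\<pi> c \<noteq> \<pi> x" using eq_iff[of c x] next_largerD(2)[OF x] c by simp
      ultimately have "\<pi> x < \<pi> c" using v by simp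
      moreover have "\<pi> c < \<pi> M" using M(4)[of c] c \<open>M < i\<close> i by auto
      ultimately show False
        using av[of M i x c] M(1) \<open>M < i\<close> next_largerD(1-3)[OF x] c by blast
    qed
  qed
  then show "i \<in> RMA n \<pi>" using i by (simp add: RMA_def)
qed

text \<open>After a descent, a later value between \<open>\<pi> i\<close> and \<open>\<pi> x\<close>
  would form a forbidden pattern with \<open>x\<close>, \<open>i\<close>, \<open>Suc i\<close>.
  Conversely, if \<open>\<pi> x = \<pi> i + 1\<close>, an ascent to an entry that is no new maximum
  would lie above \<open>\<pi> x\<close> but below some earlier entry, again forbidden.\<close>

lemma des_iff:
  assumes i: "1 \<le> i" "Suc i \<le> n"
  shows "i \<in> DES n \<pi> \<longleftrightarrow> Suc i \<notin> LMA n \<pi> \<and> (i \<in> LMA n \<pi> \<or> i \<in> VID n \<pi>)"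
proof -
  have D: "i \<in> DES n \<pi> \<longleftrightarrow> \<pi> (Suc i) < \<pi> i" using i by (auto simp: DES_def)
  have i': "i \<le> n" "1 \<le> Suc i" using i by auto
  show ?thesis unfolding D lma_iff[OF i(1) i'(1)] lma_iff[OF i'(2) i(2)]
  proof
    assume d: "\<pi> (Suc i) < \<pi> i"
    have "\<not> is_lma \<pi> (Suc i)" using not_lmaI[of i "Suc i" \<pi>] d i by simp
    moreover have "i \<in> VID n \<pi>" if nl: "\<not> is_lma \<pi> i"
    proof -
      obtain x where x: "next_larger \<pi> i x" using nl ex_next_larger by blast
      have "\<not> (i < c \<and> c \<le> n \<and> \<pi> i < \<pi> c \<and> \<pi> c < \<pi> x)" for c
      proof
        assume c: "i < c \<and> c \<le> n \<and> \<pi> i < \<pi> c \<and> \<pi> c < \<pi> x"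
        then have "Suc i < c" using d by (cases "c = Suc i") auto
        then show False using av[of x "Suc i" i c] next_largerD(1-3)[OF x] d c i by auto
      qed
      then show ?thesis using vid_iff_between[OF x i'(1)] by blast
    qed
    ultimately show "\<not> is_lma \<pi> (Suc i) \<and> (is_lma \<pi> i \<or> i \<in> VID n \<pi>)" by blast
  next
    assume h: "\<not> is_lma \<pi> (Suc i) \<and> (is_lma \<pi> i \<or> i \<in> VID n \<pi>)"
    then obtain p where p: "1 \<le> p" "p \<le> i" "\<not> \<pi> p < \<pi> (Suc i)" unfolding is_lma_def by auto
    then have p3: "\<pi> (Suc i) < \<pi> p" using neq[of p "Suc i"] by auto
    show "\<pi> (Suc i) < \<pi> i"
    proof (cases "is_lma \<pi> i")
      case True
      then have "\<pi> p \<le> \<pi> i" using p unfolding is_lma_def by (cases "p = i") (auto intro: less_imp_le)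
      then show ?thesis using p3 by simp
    next
      case False
      then obtain x where x: "next_larger \<pi> i x" using ex_next_larger by blast
      have v: "\<pi> x = Suc (\<pi> i)" using vid_iff_next_larger[OF x i'(1)] h False by blast
      show ?thesis
      proof (rule ccontr)
        assume "\<not> ?thesis"
        then have lt: "\<pi> i < \<pi> (Suc i)" using neq[of i "Suc i"] by auto
        moreover have "\<pi> (Suc i) \<noteq> \<pi> x" using eq_iff[of "Suc i" x] next_largerD(2)[OF x] by simp
        ultimately have "\<pi> x < \<pi> (Suc i)" using v by simp
        moreover have "p < i" using p p3 lt by (cases "p = i") auto
        ultimately show False using av[of p i x "Suc i"] p p3 next_largerD(1-3)[OF x] i by auto
      qed
    qed
  qed
qed

end

section \<open>A permutation is determined by its code\<close>

definition same_order :: "nat \<Rightarrow> (nat \<Rightarrow> nat) \<Rightarrow> (nat \<Rightarrow> nat) \<Rightarrow> bool" where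
  "same_order k \<pi> \<sigma> \<longleftrightarrow> (\<forall>p q. 1 \<le> p \<longrightarrow> p \<le> k \<longrightarrow> 1 \<le> q \<longrightarrow> q \<le> k \<longrightarrow> (\<pi> p < \<pi> q \<longleftrightarrow> \<sigma> p < \<sigma> q))"

lemma same_orderD:
  "same_order k \<pi> \<sigma> \<Longrightarrow> 1 \<le> p \<Longrightarrow> p \<le> k \<Longrightarrow> 1 \<le> q \<Longrightarrow> q \<le> k \<Longrightarrow> \<pi> p < \<pi> q \<longleftrightarrow> \<sigma> p < \<sigma> q"
  unfolding same_order_def by blast

lemma same_order_sym: "same_order k \<pi> \<sigma> \<Longrightarrow> same_order k \<sigma> \<pi>"
  unfolding same_order_def by blast

lemma open_pos_cong:
  assumes "same_order k \<pi> \<sigma>" "m \<le> k"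
  shows "open_pos \<pi> m = open_pos \<sigma> m"
proof -
  have sub: "open_pos \<pi> m \<subseteq> open_pos \<sigma> m" if so: "same_order k \<pi> \<sigma>" for \<pi> \<sigma>
  proof
    fix p assume p: "p \<in> open_pos \<pi> m"
    note pb = open_pos_bounds[OF p]
    show "p \<in> open_pos \<sigma> m"
    proof (rule open_posI)
      fix i q assume iq: "p < i" "i \<le> m" "1 \<le> q" "q < i" "\<sigma> i < \<sigma> q" "\<sigma> q < \<sigma> p"
      have "\<pi> i < \<pi> q" "\<pi> q < \<pi> p"
        using same_orderD[OF so, of i q] same_orderD[OF so, of q p] iq pb assms(2) by auto
      then show False using open_posD[OF p iq(1-4)] by blast
    qed (use pb in auto)
  qed
  show ?thesis using sub[OF assms(1)] sub[OF same_order_sym[OF assms(1)]] by blast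
qed

lemma is_lma_cong: "same_order k \<pi> \<sigma> \<Longrightarrow> 1 \<le> i \<Longrightarrow> i \<le> k \<Longrightarrow> is_lma \<pi> i = is_lma \<sigma> i"
  unfolding is_lma_def by (intro ball_cong refl) (simp add: same_orderD)

lemma code_cong:
  assumes "same_order k \<pi> \<sigma>" "1 \<le> i" "i \<le> k"
  shows "code \<pi> i = code \<sigma> i"
proof -
  have o: "open_pos \<pi> (i - 1) = open_pos \<sigma> (i - 1)"
    by (rule open_pos_cong[OF assms(1)]) (use assms in simp)
  have "{p \<in> open_pos \<pi> (i - 1). \<pi> p < \<pi> i} = {p \<in> open_pos \<sigma> (i - 1). \<sigma> p < \<sigma> i}"
    unfolding o
  proof (intro Collect_cong conj_cong refl)
    fix p assume "p \<in> open_pos \<sigma> (i - 1)"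
    from open_pos_bounds[OF this] show "\<pi> p < \<pi> i \<longleftrightarrow> \<sigma> p < \<sigma> i"
      using same_orderD[OF assms(1), of p i] assms by auto
  qed
  then show ?thesis using is_lma_cong[OF assms] by (simp add: code_def)
qed

lemma codes_cong:
  assumes "same_order n \<pi> \<sigma>"
  shows "codes n \<pi> = codes n \<sigma>"
  unfolding codes_def
  by (intro map_cong refl code_cong[OF assms]) auto

lemma permutes_eq_card:
  assumes "\<pi> permutes {1..n}" "i \<in> {1..n}"
  shows "\<pi> i = card {p \<in> {1..n}. \<not> \<pi> i < \<pi> p}"
proof -
  have img: "\<pi> ` {1..n} = {1..n}" by (rule permutes_image[OF assms(1)])
  have "\<pi> i \<in> {1..n}" using assms permutes_in_image by metis
  then have "\<pi> ` {p \<in> {1..n}. \<not> \<pi> i < \<pi> p} = {1..\<pi> i}"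
  proof (intro set_eqI iffI)
    fix y assume "y \<in> {1..\<pi> i}" and "\<pi> i \<in> {1..n}"
    then have "y \<in> \<pi> ` {1..n}" "\<not> \<pi> i < y" using img by auto
    then show "y \<in> \<pi> ` {p \<in> {1..n}. \<not> \<pi> i < \<pi> p}" by blast
  next
    fix y assume "y \<in> \<pi> ` {p \<in> {1..n}. \<not> \<pi> i < \<pi> p}"
    then have "y \<in> \<pi> ` {1..n}" "\<not> \<pi> i < y" by auto
    then show "y \<in> {1..\<pi> i}" using img by auto
  qed
  moreover have "inj_on \<pi> {p \<in> {1..n}. \<not> \<pi> i < \<pi> p}"
    using permutes_inj[OF assms(1)] by (rule inj_on_subset) simp
  ultimately show ?thesis using card_image by fastforce
qed

lemma same_order_eq:
  assumes "\<pi> permutes {1..n}" "\<sigma> permutes {1..n}" "same_order n \<pi> \<sigma>"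
  shows "\<pi> = \<sigma>"
proof
  fix i
  show "\<pi> i = \<sigma> i"
  proof (cases "i \<in> {1..n}")
    case True
    have "{p \<in> {1..n}. \<not> \<pi> i < \<pi> p} = {p \<in> {1..n}. \<not> \<sigma> i < \<sigma> p}"
      using same_orderD[OF assms(3), of i] True by auto
    then show ?thesis using permutes_eq_card[OF assms(1) True] permutes_eq_card[OF assms(2) True] by simp
  next
    case False
    then show ?thesis using assms permutes_not_in by metis
  qed
qed

lemma codes_inj:
  assumes "avoider n \<pi>" "avoider n \<sigma>" "codes n \<pi> = codes n \<sigma>"
  shows "\<pi> = \<sigma>"
proof -
  interpret P: avoider n \<pi> by fact
  interpret S: avoider n \<sigma> by fact
  have ceq: "code \<pi> i = code \<sigma> i" if "1 \<le> i" "i \<le> n" for i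
  proof -
    have "i - 1 < n" using that by simp
    then show ?thesis using codes_nth[of "i - 1" n \<pi>] codes_nth[of "i - 1" n \<sigma>] assms(3) that by simp
  qed
  have "same_order k \<pi> \<sigma>" if "k \<le> n" for k
    using that
  proof (induction k)
    case 0
    then show ?case by (simp add: same_order_def)
  next
    case (Suc k)
    then have so: "same_order k \<pi> \<sigma>" by simp
    have key: "\<pi> (Suc k) < \<pi> p \<longleftrightarrow> \<sigma> (Suc k) < \<sigma> p" if p: "1 \<le> p" "p \<le> k" for p
    proof (cases "is_lma \<pi> (Suc k)")
      case True
      then have "is_lma \<sigma> (Suc k)" using ceq[of "Suc k"] Suc.prems P.code_eq_0[of "Suc k"] S.code_eq_0[of "Suc k"] by simp
      then have "\<pi> p < \<pi> (Suc k)" "\<sigma> p < \<sigma> (Suc k)" using True p unfolding is_lma_def by auto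
      then show ?thesis by simp
    next
      case False
      then have F: "\<not> is_lma \<sigma> (Suc k)"
        using ceq[of "Suc k"] Suc.prems P.code_eq_0[of "Suc k"] S.code_eq_0[of "Suc k"] by simp
      obtain x where x: "next_larger \<pi> (Suc k) x" using P.ex_next_larger[OF False] by blast
      obtain y where y: "next_larger \<sigma> (Suc k) y" using S.ex_next_larger[OF F] by blast
      define U where "U = open_pos \<pi> k"
      have U: "open_pos \<sigma> k = U" using open_pos_cong[OF so, of k] U_def by simp
      have xU: "x \<in> U" and yU: "y \<in> U"
        using P.next_larger_open[OF x Suc.prems] S.next_larger_open[OF y Suc.prems] U U_def by auto
      have Ub: "1 \<le> p \<and> p \<le> k" if "p \<in> U" for p using open_pos_bounds that unfolding U_def by blast
      have le: "\<pi> p \<le> \<pi> q \<longleftrightarrow> \<sigma> p \<le> \<sigma> q" if "1 \<le> p" "p \<le> k" "1 \<le> q" "q \<le> k" for p q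
        using same_orderD[OF so, of q p] that by (simp add: not_less[symmetric])
      have eqs: "{p \<in> U. \<sigma> p \<le> \<sigma> y} = {p \<in> U. \<pi> p \<le> \<pi> y}" using le Ub yU by blast
      \<comment> \<open>Equal codes give \<open>x\<close> and \<open>y\<close> the same rank in the
        common set of open positions.\<close>
      have cards: "card {p \<in> U. \<pi> p \<le> \<pi> x} = card {p \<in> U. \<pi> p \<le> \<pi> y}"
        using P.code_next_larger[OF x Suc.prems] S.code_next_larger[OF y Suc.prems] ceq[of "Suc k"] Suc.prems
          eqs U by (simp add: U_def)
      have fin: "finite U" by (simp add: U_def)
      have "\<not> \<pi> x < \<pi> y"
      proof
        assume "\<pi> x < \<pi> y"
        then have "{p \<in> U. \<pi> p \<le> \<pi> x} \<subseteq> {p \<in> U. \<pi> p \<le> \<pi> y}"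
          "y \<in> {p \<in> U. \<pi> p \<le> \<pi> y}" "y \<notin> {p \<in> U. \<pi> p \<le> \<pi> x}" using yU by auto
        then have "{p \<in> U. \<pi> p \<le> \<pi> x} \<subset> {p \<in> U. \<pi> p \<le> \<pi> y}" by blast
        from psubset_card_mono[OF _ this] show False using cards fin by simp
      qed
      moreover have "\<not> \<pi> y < \<pi> x"
      proof
        assume "\<pi> y < \<pi> x"
        then have "{p \<in> U. \<pi> p \<le> \<pi> y} \<subseteq> {p \<in> U. \<pi> p \<le> \<pi> x}"
          "x \<in> {p \<in> U. \<pi> p \<le> \<pi> x}" "x \<notin> {p \<in> U. \<pi> p \<le> \<pi> y}" using xU by auto
        then have "{p \<in> U. \<pi> p \<le> \<pi> y} \<subset> {p \<in> U. \<pi> p \<le> \<pi> x}" by blast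
        from psubset_card_mono[OF _ this] show False using cards fin by simp
      qed
      ultimately have xy: "x = y" using P.neq by blast
      have "\<pi> (Suc k) < \<pi> p \<longleftrightarrow> \<pi> x \<le> \<pi> p"
        using next_largerD(3)[OF x] next_largerD(4)[OF x, of p] p by auto
      moreover have "\<sigma> (Suc k) < \<sigma> p \<longleftrightarrow> \<sigma> x \<le> \<sigma> p"
        using next_largerD(3)[OF y] next_largerD(4)[OF y, of p] p xy by auto
      ultimately show ?thesis using le[of x p] Ub[OF xU] p by simp
    qed
    have key2: "\<pi> p < \<pi> (Suc k) \<longleftrightarrow> \<sigma> p < \<sigma> (Suc k)" if p: "1 \<le> p" "p \<le> k" for p
      using key[OF p] P.neq[of p "Suc k"] S.neq[of p "Suc k"] p by auto
    show ?case unfolding same_order_def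
      using key key2 same_orderD[OF so] by (metis le_Suc_eq less_irrefl)
  qed
  then show ?thesis using same_order_eq P.perm S.perm by blast
qed

section \<open>Every valid list is a code\<close>

lemma ex_rank:
  fixes f :: "'a \<Rightarrow> nat"
  assumes "finite U" "inj_on f U" "j < card U"
  shows "\<exists>x\<in>U. card {p \<in> U. f p < f x} = j"
  using assms
proof (induction "card U" arbitrary: U)
  case 0
  then show ?case by simp
next
  case (Suc m)
  then have "U \<noteq> {}" by auto
  obtain M where M: "M \<in> U" "\<And>p. p \<in> U \<Longrightarrow> f p \<le> f M"
  proof -
    have "Max (f ` U) \<in> f ` U" using Suc.prems(1) \<open>U \<noteq> {}\<close> by (intro Max_in) auto
    then obtain M where "M \<in> U" "f M = Max (f ` U)" by auto
    then show ?thesis using that[of M] Max_ge[of "f ` U"] Suc.prems(1) by auto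
  qed
  have lt: "f p < f M" if "p \<in> U - {M}" for p
    using M that inj_onD[OF Suc.prems(2), of p M] by (auto simp: order_less_le)
  show ?case
  proof (cases "j = m")
    case True
    have "{p \<in> U. f p < f M} = U - {M}" using lt by auto
    then show ?thesis using M(1) Suc.hyps(2) Suc.prems(1) True by (intro bexI[of _ M]) auto
  next
    case False
    have "m = card (U - {M})" using Suc M(1) by simp
    moreover have "j < card (U - {M})" using False Suc.prems(3) Suc.hyps(2) M(1) Suc.prems(1) by simp
    moreover have "inj_on f (U - {M})" using Suc.prems(2) by (rule inj_on_subset) auto
    ultimately obtain x where x: "x \<in> U - {M}" "card {p \<in> U - {M}. f p < f x} = j"
      using Suc.hyps(1)[of "U - {M}"] Suc.prems(1) by blast
    have "{p \<in> U - {M}. f p < f x} = {p \<in> U. f p < f x}" using lt[OF x(1)] by auto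
    then show ?thesis using x by auto
  qed
qed

definition insert_last :: "nat \<Rightarrow> nat \<Rightarrow> (nat \<Rightarrow> nat) \<Rightarrow> nat \<Rightarrow> nat" where
  "insert_last n v \<pi> i =
     (if i = Suc n then v else if i \<in> {1..n} \<and> v \<le> \<pi> i then Suc (\<pi> i) else \<pi> i)"

lemma insert_last_permutes:
  assumes "\<pi> permutes {1..n}" "v \<in> {1..n}"
  shows "insert_last n v \<pi> permutes {1..Suc n}"
proof (rule bij_imp_permutes)
  have rng: "\<pi> i \<in> {1..n}" if "i \<in> {1..n}" for i using that permutes_in_image[OF assms(1)] by blast
  have inj: "\<pi> i = \<pi> j \<Longrightarrow> i = j" for i j using permutes_inj[OF assms(1)] by (auto dest: injD)
  show "insert_last n v \<pi> i = i" if "i \<notin> {1..Suc n}" for i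
    using that permutes_not_in[OF assms(1), of i] by (auto simp: insert_last_def)
  have "inj_on (insert_last n v \<pi>) {1..Suc n}"
  proof (rule inj_onI)
    fix i j assume h: "i \<in> {1..Suc n}" "j \<in> {1..Suc n}" "insert_last n v \<pi> i = insert_last n v \<pi> j"
    then show "i = j" using inj[of i j]
      by (auto simp: insert_last_def split: if_splits)
  qed
  moreover have "insert_last n v \<pi> ` {1..Suc n} \<subseteq> {1..Suc n}"
  proof
    fix y assume "y \<in> insert_last n v \<pi> ` {1..Suc n}"
    then obtain i where i: "i \<in> {1..Suc n}" "y = insert_last n v \<pi> i" by blast
    show "y \<in> {1..Suc n}" using rng[of i] assms(2) i by (cases "i = Suc n") (auto simp: insert_last_def)
  qed
  ultimately show "bij_betw (insert_last n v \<pi>) {1..Suc n} {1..Suc n}"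
    by (simp add: bij_betw_def card_image card_subset_eq)
qed

lemma insert_last_same_order: "same_order n \<pi> (insert_last n v \<pi>)"
  unfolding same_order_def insert_last_def by auto

lemma codes_surj:
  "valid 0 xs \<Longrightarrow> \<exists>\<pi>. avoider (length xs) \<pi> \<and> codes (length xs) \<pi> = xs"
proof (induction xs rule: rev_induct)
  case Nil
  have "avoider 0 id" by unfold_locales (auto simp: permutes_id avoids_def)
  then show ?case by (auto simp: codes_def)
next
  case (snoc j xs)
  define n where "n = length xs"
  obtain \<pi> where "avoider n \<pi>" and cod: "codes n \<pi> = xs"
    using snoc by (auto simp: valid_append n_def)
  interpret avoider n \<pi> by fact
  show ?case
  proof (cases "j = 0")
    case True
    \<comment> \<open>For a new maximum \<open>\<pi>\<close> itself serves, as it already fixes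
      \<open>Suc n\<close>.\<close>
    have fix_top: "\<pi> (Suc n) = Suc n" using permutes_not_in[OF perm] by simp
    have less: "\<pi> p < Suc n" if "1 \<le> p" "p \<le> n" for p
    proof -
      have "\<pi> p \<in> {1..n}" using permutes_in_image[OF perm, of p] that by simp
      then show ?thesis by simp
    qed
    have "avoider (Suc n) \<pi>"
    proof
      show "\<pi> permutes {1..Suc n}" by (rule permutes_subset[OF perm]) auto
      show "avoids (Suc n) \<pi>" unfolding avoids_def
      proof safe
        fix p q i c
        assume h: "1 \<le> p" "p < i" "1 \<le> q" "q < i" "i < c" "c \<le> Suc n" "\<pi> i < \<pi> q" "\<pi> q < \<pi> c" "\<pi> c < \<pi> p"
        have "c \<noteq> Suc n" using fix_top less[of p] h by auto
        then have "c \<le> n" using h by simp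
        then show False using av[of p i q c] h by blast
      qed
    qed
    moreover have "is_lma \<pi> (Suc n)" using less fix_top by (auto simp: is_lma_def)
    then have "codes (Suc n) \<pi> = xs @ [j]" using cod True by (simp add: codes_Suc code_def)
    ultimately show ?thesis by (auto simp: n_def)
  next
    case False
    have "j \<le> card (open_pos \<pi> n)" using snoc.prems valid_codes[of n] cod False by (simp add: valid_append)
    then have "j - 1 < card (open_pos \<pi> n)" using False by linarith
    moreover have "inj_on \<pi> (open_pos \<pi> n)" using eq_iff by (auto intro: inj_onI)
    ultimately obtain x where x: "x \<in> open_pos \<pi> n" "card {p \<in> open_pos \<pi> n. \<pi> p < \<pi> x} = j - 1"
      using ex_rank[OF finite_open_pos, of \<pi> \<pi> n "j - 1"] by auto
    define v where "v = \<pi> x"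
    define \<sigma> where "\<sigma> = insert_last n v \<pi>"
    have xb: "1 \<le> x" "x \<le> n" using open_pos_bounds[OF x(1)] by auto
    have "v \<in> {1..n}" using permutes_in_image[OF perm, of x] xb by (simp add: v_def)
    then have ps: "\<sigma> permutes {1..Suc n}" unfolding \<sigma>_def by (rule insert_last_permutes[OF perm])
    have so: "same_order n \<pi> \<sigma>" unfolding \<sigma>_def by (rule insert_last_same_order)
    have top: "\<sigma> (Suc n) = v" by (simp add: \<sigma>_def insert_last_def)
    have lt: "\<sigma> p < v \<longleftrightarrow> \<pi> p < v" "v < \<sigma> p \<longleftrightarrow> v \<le> \<pi> p" if "1 \<le> p" "p \<le> n" for p
      using that by (auto simp: \<sigma>_def insert_last_def)
    have "avoider (Suc n) \<sigma>"
    proof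
      show "\<sigma> permutes {1..Suc n}" by fact
      show "avoids (Suc n) \<sigma>" unfolding avoids_def
      proof safe
        fix p q i c
        assume h: "1 \<le> p" "p < i" "1 \<le> q" "q < i" "i < c" "c \<le> Suc n" "\<sigma> i < \<sigma> q" "\<sigma> q < \<sigma> c" "\<sigma> c < \<sigma> p"
        then have iq: "\<pi> i < \<pi> q" using same_orderD[OF so, of i q] by simp
        show False
        proof (cases "c = Suc n")
          case False
          then have "\<pi> q < \<pi> c" "\<pi> c < \<pi> p"
            using same_orderD[OF so, of q c] same_orderD[OF so, of c p] h by auto
          then show False using av[of p i q c] h iq False by simp
        next
          case True
          then have v: "\<pi> q < \<pi> x" "\<pi> x \<le> \<pi> p" using h lt[of q] lt[of p] top unfolding v_def by auto
          show False
          \<comment> \<open>If \<open>x\<close> precedes \<open>i\<close>, its site would be closed;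
            if it follows \<open>i\<close>, it already plays the last letter of a forbidden pattern
            in \<open>\<pi>\<close>.\<close>
          proof (cases "x < i")
            case True
            then show False using open_posD[OF x(1), of i q] h iq v \<open>c = Suc n\<close> by simp
          next
            case False
            then have "i < x" using iq v by (cases "x = i") auto
            moreover have "\<pi> x < \<pi> p" using v eq_iff[of x p] \<open>i < x\<close> h by auto
            ultimately show False using av[of p i q x] h iq v xb by simp
          qed
        qed
      qed
    qed
    moreover have "code \<sigma> (Suc n) = j"
    proof -
      have "v < \<sigma> x" using lt(2)[of x] xb by (simp add: v_def)
      then have nl: "\<not> is_lma \<sigma> (Suc n)" using not_lmaI[of x "Suc n" \<sigma>] xb top by simp
      have "{p \<in> open_pos \<sigma> n. \<sigma> p < \<sigma> (Suc n)} = {p \<in> open_pos \<pi> n. \<pi> p < \<pi> x}"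
        unfolding open_pos_cong[OF so order_refl, symmetric] top
        using lt(1) open_pos_bounds unfolding v_def by blast
      then show ?thesis using nl x(2) False by (simp add: code_def)
    qed
    then have "codes (Suc n) \<sigma> = xs @ [j]" using cod codes_cong[OF so] by (simp add: codes_Suc)
    ultimately show ?thesis by (auto simp: n_def)
  qed
qed

section \<open>Inversion sequences\<close>

definition seq_code :: "(nat \<Rightarrow> nat) \<Rightarrow> nat \<Rightarrow> nat" where
  "seq_code e i = (if e i = 0 then 0 else i - e i)"

definition seq_codes :: "nat \<Rightarrow> (nat \<Rightarrow> nat) \<Rightarrow> nat list" where
  "seq_codes n e = map (seq_code e) [1..<Suc n]"

lemma seq_codes_Suc: "seq_codes (Suc n) e = seq_codes n e @ [seq_code e (Suc n)]"
  by (simp add: seq_codes_def)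

lemma length_seq_codes [simp]: "length (seq_codes n e) = n"
  by (simp add: seq_codes_def)

lemma seq_codes_nth: "i < n \<Longrightarrow> seq_codes n e ! i = seq_code e (Suc i)"
  by (simp add: seq_codes_def del: upt_Suc)

lemma take_seq_codes: "k \<le> n \<Longrightarrow> take k (seq_codes n e) = seq_codes k e"
  by (simp add: seq_codes_def take_map take_upt del: upt_Suc)

lemma set_drop_seq_codes: "set (drop i (seq_codes n e)) = seq_code e ` {i<..n}"
  by (auto simp: seq_codes_def drop_map drop_upt simp del: upt_Suc)

text \<open>\<open>e 1 = 0\<close> supplies the smallest letter of the pattern, and in an occurrence
  of 021 the other two letters are nonzero.\<close>

lemma inv_seqs_021_iff:
  "e \<in> inv_seqs_021 n \<longleftrightarrow> e \<in> inv_seqs n \<and>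
     (\<forall>i j. 1 \<le> i \<longrightarrow> i < j \<longrightarrow> j \<le> n \<longrightarrow> e i \<noteq> 0 \<longrightarrow> e j \<noteq> 0 \<longrightarrow> e i \<le> e j)"
proof (cases "e \<in> inv_seqs n")
  case False
  then show ?thesis by (simp add: inv_seqs_021_def)
next
  case True
  have lt: "e i < i" if "1 \<le> i" "i \<le> n" for i
    using True that unfolding inv_seqs_def by (metis PiE_mem atLeastAtMost_iff atLeastLessThan_iff)
  have iff: "(\<exists>i j k. 1 \<le> i \<and> i < j \<and> j < k \<and> k \<le> n \<and> e i < e k \<and> e k < e j) \<longleftrightarrow>
    (\<exists>i j. 1 \<le> i \<and> i < j \<and> j \<le> n \<and> e i \<noteq> 0 \<and> e j \<noteq> 0 \<and> e j < e i)" (is "?L \<longleftrightarrow> ?R")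
  proof
    assume ?L
    then obtain i j k where *: "1 \<le> i" "i < j" "j < k" "k \<le> n" "e i < e k" "e k < e j" by blast
    then show ?R by (intro exI[of _ j] exI[of _ k]) auto
  next
    assume ?R
    then obtain i j where *: "1 \<le> i" "i < j" "j \<le> n" "e i \<noteq> 0" "e j \<noteq> 0" "e j < e i" by blast
    have "e 1 = 0" using lt[of 1] * by simp
    moreover have "1 < i" using * \<open>e 1 = 0\<close> by (cases "i = 1") auto
    ultimately show ?L using * by (intro exI[of _ 1] exI[of _ i] exI[of _ j]) auto
  qed
  show ?thesis unfolding inv_seqs_021_def mem_Collect_eq iff using True by (meson not_le)
qed

text \<open>For sequences avoiding 021 this is also the maximum of the prefix, and so equals
  \<open>d\<^sub>k\<close> for positions \<open>k\<close>.\<close>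

fun last_nonzero :: "(nat \<Rightarrow> nat) \<Rightarrow> nat \<Rightarrow> nat" where
  "last_nonzero e 0 = 0"
| "last_nonzero e (Suc k) = (if e (Suc k) = 0 then last_nonzero e k else e (Suc k))"

section \<open>Statistics of an inversion sequence read from its code\<close>

locale seq_021 =
  fixes n :: nat and e :: "nat \<Rightarrow> nat"
  assumes seq: "e \<in> inv_seqs_021 n"
begin

lemma lt: "1 \<le> i \<Longrightarrow> i \<le> n \<Longrightarrow> e i < i"
  using seq unfolding inv_seqs_021_iff inv_seqs_def
  by (metis PiE_mem atLeastAtMost_iff atLeastLessThan_iff)

lemma mono: "1 \<le> i \<Longrightarrow> i < j \<Longrightarrow> j \<le> n \<Longrightarrow> e j \<noteq> 0 \<Longrightarrow> e i \<le> e j"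
  using seq unfolding inv_seqs_021_iff by (cases "e i = 0") auto

lemma seq_code_eq_0: "1 \<le> i \<Longrightarrow> i \<le> n \<Longrightarrow> seq_code e i = 0 \<longleftrightarrow> e i = 0"
  using lt[of i] by (simp add: seq_code_def)

lemma valid_seq_codes: "valid 0 (seq_codes n e)"
  unfolding valid_iff_nth
proof (intro conjI allI impI)
  fix i assume "i < length (seq_codes n e)"
  then show "seq_codes n e ! i \<le> 0 + i"
    by (auto simp: seq_codes_nth seq_code_def)
next
  fix p i assume h: "p < i" "i < length (seq_codes n e)" "seq_codes n e ! p \<noteq> 0"
  then have "e (Suc p) \<noteq> 0" by (simp add: seq_codes_nth seq_code_def split: if_splits)
  then show "seq_codes n e ! i \<le> seq_codes n e ! p + (i - p)"
    using h mono[of "Suc p" "Suc i"] lt[of "Suc p"] by (auto simp: seq_codes_nth seq_code_def)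
qed

lemma le_last_nonzero: "1 \<le> p \<Longrightarrow> p \<le> k \<Longrightarrow> k \<le> n \<Longrightarrow> e p \<le> last_nonzero e k"
proof (induction k)
  case (Suc k)
  show ?case
  proof (cases "p = Suc k")
    case False
    then show ?thesis using Suc mono[of p "Suc k"] by auto
  qed simp
qed simp

lemma last_nonzero_attained: "last_nonzero e k = 0 \<or> (\<exists>p. 1 \<le> p \<and> p \<le> k \<and> e p = last_nonzero e k)"
proof (induction k)
  case (Suc k)
  show ?case
  proof (cases "e (Suc k) = 0")
    case True
    then show ?thesis using Suc le_SucI by auto
  next
    case False
    then show ?thesis by (auto intro!: exI[of _ "Suc k"])
  qed
qed simp

lemma last_nonzero_le: "k < c \<Longrightarrow> c \<le> n \<Longrightarrow> e c \<noteq> 0 \<Longrightarrow> last_nonzero e k \<le> e c"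
  using last_nonzero_attained[of k] mono[of _ c] by force

lemma last_nonzero_less: "1 \<le> k \<Longrightarrow> k \<le> n \<Longrightarrow> last_nonzero e k < k"
  using last_nonzero_attained[of k] lt by fastforce

lemma last_nonzero_nonzero: "1 \<le> k \<Longrightarrow> e k \<noteq> 0 \<Longrightarrow> last_nonzero e k = e k"
  by (cases k) auto

lemma ex_nonzero_iff:
  assumes "k \<le> n"
  shows "(\<exists>p<k. seq_codes n e ! p \<noteq> 0) \<longleftrightarrow> last_nonzero e k \<noteq> 0"
proof
  assume "\<exists>p<k. seq_codes n e ! p \<noteq> 0"
  then obtain p where "p < k" "e (Suc p) \<noteq> 0"
    using assms by (auto simp: seq_codes_nth seq_code_def split: if_splits)
  then show "last_nonzero e k \<noteq> 0" using le_last_nonzero[of "Suc p" k] assms by auto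
next
  assume "last_nonzero e k \<noteq> 0"
  then obtain p where p: "1 \<le> p" "p \<le> k" "e p \<noteq> 0" using last_nonzero_attained[of k] by auto
  then have "seq_codes n e ! (p - 1) \<noteq> 0" using assms seq_code_eq_0[of p] by (simp add: seq_codes_nth)
  moreover have "p - 1 < k" using p by simp
  ultimately show "\<exists>p<k. seq_codes n e ! p \<noteq> 0" by blast
qed

text \<open>A nonzero code \<open>x\<close> leads to height \<open>Suc x\<close>, whence the extra
  \<open>Suc\<close> once a nonzero entry has occurred. The Boolean of \<open>expo_flags\<close>
  compensates for this.\<close>

lemma hgt_seq_codes:
  "k \<le> n \<Longrightarrow> hgt 0 (seq_codes k e) = (if last_nonzero e k = 0 then k else Suc (k - last_nonzero e k))"
proof (induction k)
  case 0
  then show ?case by (simp add: seq_codes_def)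
next
  case (Suc k)
  show ?case
  proof (cases "e (Suc k) = 0")
    case True
    have "last_nonzero e k \<le> k" using last_nonzero_less[of k] Suc.prems by (cases "k = 0") auto
    then show ?thesis using Suc True by (auto simp: seq_codes_Suc hgt_append seq_code_def)
  next
    case False
    then show ?thesis using Suc seq_code_eq_0[of "Suc k"]
      by (auto simp: seq_codes_Suc hgt_append seq_code_def)
  qed
qed

lemma expo_d_eq: "1 \<le> i \<Longrightarrow> i \<le> n \<Longrightarrow> expo_d e i = last_nonzero e i"
proof (cases "e i = 0")
  case False
  assume "1 \<le> i"
  then show ?thesis using False last_nonzero_nonzero by (simp add: expo_d_def)
next
  case True
  assume i: "1 \<le> i" "i \<le> n"
  have "Max (e ` {1..i}) = last_nonzero e i"
  proof (rule Max_eqI)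
    show "y \<le> last_nonzero e i" if "y \<in> e ` {1..i}" for y
      using that le_last_nonzero i by auto
    show "last_nonzero e i \<in> e ` {1..i}"
      using last_nonzero_attained[of i] True i by force
  qed simp
  then show ?thesis using True by (simp add: expo_d_def)
qed

lemma next_same_seq_codes:
  "next_same j (drop i (seq_codes n e)) \<longleftrightarrow>
    (\<exists>c. i < c \<and> c \<le> n \<and> (\<forall>m. i < m \<longrightarrow> m < c \<longrightarrow> e m = 0) \<and> seq_code e c = j + (c - i))"
    (is "?L \<longleftrightarrow> ?R")
proof -
  have "?L \<longleftrightarrow> (\<exists>p<n - i. (\<forall>m<p. e (Suc (i + m)) = 0) \<and> seq_code e (Suc (i + p)) = Suc (j + p))"
    unfolding next_same_iff
  proof (intro ex_cong1 conj_cong)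
    fix p
    show "p < length (drop i (seq_codes n e)) \<longleftrightarrow> p < n - i" by simp
    assume p: "p < n - i"
    show "(\<forall>m<p. drop i (seq_codes n e) ! m = 0) \<longleftrightarrow> (\<forall>m<p. e (Suc (i + m)) = 0)"
    proof (intro all_cong)
      fix m assume "m < p"
      then show "drop i (seq_codes n e) ! m = 0 \<longleftrightarrow> e (Suc (i + m)) = 0"
        using p seq_code_eq_0[of "Suc (i + m)"] by (simp add: seq_codes_nth)
    qed
    show "drop i (seq_codes n e) ! p = Suc (j + p) \<longleftrightarrow> seq_code e (Suc (i + p)) = Suc (j + p)"
      using p by (simp add: seq_codes_nth)
  qed
  also have "\<dots> \<longleftrightarrow> ?R"
  proof
    assume "\<exists>p<n - i. (\<forall>m<p. e (Suc (i + m)) = 0) \<and> seq_code e (Suc (i + p)) = Suc (j + p)"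
    then obtain p where p: "p < n - i" "\<And>m. m < p \<Longrightarrow> e (Suc (i + m)) = 0"
      "seq_code e (Suc (i + p)) = Suc (j + p)" by blast
    have "e m = 0" if "i < m" "m < Suc (i + p)" for m using p(2)[of "m - Suc i"] that by simp
    then show ?R using p by (intro exI[of _ "Suc (i + p)"]) simp
  next
    assume ?R
    then obtain c where c: "i < c" "c \<le> n" "\<And>m. i < m \<Longrightarrow> m < c \<Longrightarrow> e m = 0"
      "seq_code e c = j + (c - i)" by blast
    then show "\<exists>p<n - i. (\<forall>m<p. e (Suc (i + m)) = 0) \<and> seq_code e (Suc (i + p)) = Suc (j + p)"
      by (intro exI[of _ "c - Suc i"]) auto
  qed
  finally show ?thesis .
qed

text \<open>\<open>i - v\<close> is the code of the value \<open>v\<close> at position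
  \<open>i\<close>. As the later nonzero entries increase weakly from at least \<open>v\<close>, the
  value \<open>v\<close> occurs among them iff the first one has it.\<close>

lemma next_same_iff_ex:
  assumes v: "1 \<le> v" "v \<le> i" and ge: "\<And>c. i < c \<Longrightarrow> c \<le> n \<Longrightarrow> e c \<noteq> 0 \<Longrightarrow> v \<le> e c"
  shows "next_same (i - v) (drop i (seq_codes n e)) \<longleftrightarrow> (\<exists>c\<in>{i<..n}. e c = v)"
proof
  assume "next_same (i - v) (drop i (seq_codes n e))"
  then obtain c where c: "i < c" "c \<le> n" "seq_code e c = i - v + (c - i)"
    unfolding next_same_seq_codes by blast
  then have "e c = v" using v lt[of c] by (auto simp: seq_code_def split: if_splits)
  then show "\<exists>c\<in>{i<..n}. e c = v" using c by auto
next
  assume "\<exists>c\<in>{i<..n}. e c = v"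
  then obtain b where b: "i < b" "b \<le> n" "e b = v" by auto
  define P where "P = (\<lambda>c. i < c \<and> e c \<noteq> 0)"
  have Pb: "P b" using b v by (simp add: P_def)
  define c where "c = (LEAST c. P c)"
  have Pc: "P c" unfolding c_def using Pb by (rule LeastI)
  have cb: "c \<le> b" unfolding c_def using Pb by (rule Least_le)
  have z: "e m = 0" if "i < m" "m < c" for m
  proof -
    have "\<not> P m" using not_less_Least[of m P] that(2) unfolding c_def by blast
    then show ?thesis using that(1) by (simp add: P_def)
  qed
  have "v \<le> e c" using ge[of c] Pc cb b by (simp add: P_def)
  moreover have "e c \<le> v" using mono[of c b] Pc cb b v by (cases "c = b") (auto simp: P_def)
  ultimately have "e c = v" by simp
  then have "seq_code e c = i - v + (c - i)" using v Pc by (simp add: seq_code_def P_def)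
  then show "next_same (i - v) (drop i (seq_codes n e))"
    unfolding next_same_seq_codes using Pc cb b z by (intro exI[of _ c]) (auto simp: P_def)
qed

lemma above_seq_codes:
  "above k (drop i (seq_codes n e)) \<longleftrightarrow> (\<forall>c\<in>{i<..n}. e c \<noteq> 0 \<longrightarrow> k < seq_code e c)"
proof -
  have "above k (drop i (seq_codes n e)) \<longleftrightarrow> (\<forall>c\<in>{i<..n}. seq_code e c = 0 \<or> k < seq_code e c)"
    unfolding set_drop_seq_codes by simp
  also have "\<dots> \<longleftrightarrow> (\<forall>c\<in>{i<..n}. e c \<noteq> 0 \<longrightarrow> k < seq_code e c)"
    using seq_code_eq_0 by (intro ball_cong refl) auto
  finally show ?thesis .
qed

lemma zero_iff_flag: "i < n \<Longrightarrow> Suc i \<in> ZERO n e \<longleftrightarrow> seq_codes n e ! i = 0"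
  using seq_code_eq_0[of "Suc i"] by (simp add: ZERO_def seq_codes_nth)

lemma ema_iff_flag: "i < n \<Longrightarrow> Suc i \<in> EMA n e \<longleftrightarrow> i = 0 \<or> seq_codes n e ! i = 1"
  using lt[of "Suc i"] by (auto simp: EMA_def seq_codes_nth seq_code_def)

lemma dist_iff_flag:
  assumes "i < n"
  shows "Suc i \<in> DIST n e \<longleftrightarrow> dist_flags (seq_codes n e) ! i"
proof (cases "e (Suc i) = 0")
  case True
  then show ?thesis using assms by (simp add: DIST_def dist_flags_nth seq_codes_nth seq_code_def)
next
  case False
  have lt': "e (Suc i) < Suc i" using lt[of "Suc i"] assms by simp
  have "next_same (Suc i - e (Suc i)) (drop (Suc i) (seq_codes n e)) \<longleftrightarrow> (\<exists>c\<in>{Suc i<..n}. e c = e (Suc i))"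
    by (rule next_same_iff_ex) (use False lt' mono[of "Suc i"] in auto)
  moreover have "seq_codes n e ! i = Suc i - e (Suc i)" "seq_codes n e ! i \<noteq> 0"
    using assms False lt' by (simp_all add: seq_codes_nth seq_code_def)
  ultimately have "dist_flags (seq_codes n e) ! i \<longleftrightarrow> \<not> (\<exists>c\<in>{Suc i<..n}. e c = e (Suc i))"
    using assms by (simp add: dist_flags_nth)
  moreover have "Suc i \<in> {2..n}" using False lt' assms by auto
  ultimately show ?thesis using False unfolding DIST_def by (auto dest: sym)
qed

text \<open>Two equal nonzero entries around \<open>i\<close> squeeze the last nonzero value before
  \<open>i\<close> between them.\<close>

lemma expo_C_iff:
  assumes "1 \<le> i" "i \<le> n" "e i = 0"
  shows "i \<in> expo_C n e \<longleftrightarrow> last_nonzero e i \<noteq> 0 \<and> (\<exists>c\<in>{i<..n}. e c = last_nonzero e i)"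
proof
  assume "i \<in> expo_C n e"
  then obtain a b where ab: "1 \<le> a" "a < i" "i < b" "b \<le> n" "e a = e b" "e b \<noteq> 0"
    by (auto simp: expo_C_def)
  have "e b = last_nonzero e i"
    using le_last_nonzero[of a i] last_nonzero_le[of i b] ab assms by simp
  then show "last_nonzero e i \<noteq> 0 \<and> (\<exists>c\<in>{i<..n}. e c = last_nonzero e i)" using ab by auto
next
  assume h: "last_nonzero e i \<noteq> 0 \<and> (\<exists>c\<in>{i<..n}. e c = last_nonzero e i)"
  then obtain a where a: "1 \<le> a" "a \<le> i" "e a = last_nonzero e i" using last_nonzero_attained[of i] by auto
  then have "a \<in> {1..<i}" using h assms(3) by (cases "a = i") auto
  moreover obtain c where "c \<in> {i<..n}" "e a = e c" "e c \<noteq> 0" using h a(3) by auto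
  moreover have "i \<in> {1..n}" using assms by simp
  ultimately show "i \<in> expo_C n e" unfolding expo_C_def using assms(3) by blast
qed

lemma expo_iff:
  assumes i: "1 \<le> i" "i \<le> n"
  shows "i \<in> EXPO n e \<longleftrightarrow> i \<notin> expo_C n e \<and> above (i - last_nonzero e i) (drop i (seq_codes n e))"
proof -
  let ?M = "last_nonzero e"
  have less: "?M j < j" if "1 \<le> j" "j \<le> n" for j using last_nonzero_less that by blast
  have "(\<forall>j\<in>{i<..n}. int i - int (expo_d e i) < int j - int (expo_d e j)) \<longleftrightarrow>
      (\<forall>c\<in>{i<..n}. e c \<noteq> 0 \<longrightarrow> i - ?M i < seq_code e c)" (is "?L \<longleftrightarrow> ?R")
  proof
    assume L: ?L
    show ?R
    proof (intro ballI impI)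
      fix c assume c: "c \<in> {i<..n}" "e c \<noteq> 0"
      then have "int i - int (?M i) < int c - int (e c)"
      proof -
        have "int i - int (expo_d e i) < int c - int (expo_d e c)" using L c(1) by blast
        moreover have "expo_d e c = e c" using c(2) by (simp add: expo_d_def)
        ultimately show ?thesis using expo_d_eq[OF i] by simp
      qed
      then show "i - ?M i < seq_code e c"
        using less[of i] i lt[of c] c by (simp add: seq_code_def)
    qed
  next
    assume R: ?R
    show ?L
    proof
      fix j assume j: "j \<in> {i<..n}"
      have "int i - int (?M i) < int j - int (?M j)"
      \<comment> \<open>If \<open>d\<^sub>j\<close> exceeds \<open>d\<^sub>i\<close>, it is attained
        at some \<open>p\<close> in \<open>{i<..j}\<close>, and the inequality for \<open>p\<close>
        carries over to \<open>j\<close>.\<close>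
      proof (cases "?M j \<le> ?M i")
        case True
        then show ?thesis using j by auto
      next
        case False
        then obtain p where p: "1 \<le> p" "p \<le> j" "e p = ?M j" using last_nonzero_attained[of j] by auto
        have "i < p"
        proof (rule ccontr)
          assume "\<not> i < p"
          then show False using le_last_nonzero[of p i] p i False by simp
        qed
        then have "p \<in> {i<..n}" using p(2) j by simp
        moreover have ep: "e p \<noteq> 0" using p False by auto
        ultimately have "i - ?M i < seq_code e p" using R by blast
        then have "i - ?M i < p - e p" using ep by (simp add: seq_code_def)
        then show ?thesis using p less[of i] i by linarith
      qed
      then show "int i - int (expo_d e i) < int j - int (expo_d e j)"
        using expo_d_eq i j by simp
    qed
  qed
  then show ?thesis using i unfolding EXPO_def above_seq_codes mem_Collect_eq atLeastAtMost_iff by blast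
qed

lemma expo_iff_flag:
  assumes i: "i < n"
  shows "Suc i \<in> EXPO n e \<longleftrightarrow> expo_flags False 0 (seq_codes n e) ! i"
proof (cases "e (Suc i) = 0")
  case False
  then have "seq_codes n e ! i = Suc i - e (Suc i)" "seq_codes n e ! i \<noteq> 0"
    using seq_code_eq_0[of "Suc i"] i by (simp_all add: seq_codes_nth seq_code_def)
  moreover have "Suc i \<notin> expo_C n e" using False by (simp add: expo_C_def)
  moreover have "last_nonzero e (Suc i) = e (Suc i)" using False by simp
  ultimately show ?thesis using expo_iff[of "Suc i"] i unfolding expo_flags_nth[of i "seq_codes n e" False 0, unfolded length_seq_codes, OF i] by simp
next
  case True
  let ?v = "last_nonzero e i"
  have v: "last_nonzero e (Suc i) = ?v" using True by simp
  have xi: "seq_codes n e ! i = 0" using True i by (simp add: seq_codes_nth seq_code_def)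
  \<comment> \<open>Once a nonzero entry has occurred, this height is exactly
    \<open>Suc i - ?v\<close>; before that it is one less than \<open>Suc i\<close>.\<close>
  have h: "hgt 0 (take i (seq_codes n e)) = (if ?v = 0 then i else Suc (i - ?v))"
    using hgt_seq_codes[of i] i by (simp add: take_seq_codes)
  have ex: "(\<exists>p<i. seq_codes n e ! p \<noteq> 0) \<longleftrightarrow> ?v \<noteq> 0" using ex_nonzero_iff[of i] i by simp
  have vi: "?v \<le> i" using last_nonzero_less[of "Suc i"] i v by simp
  have "next_same (Suc i - ?v) (drop (Suc i) (seq_codes n e)) \<longleftrightarrow> (\<exists>c\<in>{Suc i<..n}. e c = ?v)" if "?v \<noteq> 0"
    by (rule next_same_iff_ex) (use that vi last_nonzero_le[of "Suc i"] v in auto)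
  then show ?thesis
    using expo_iff[of "Suc i"] expo_C_iff[of "Suc i"] True i xi h ex v vi
    unfolding expo_flags_nth[of i "seq_codes n e" False 0, unfolded length_seq_codes, OF i]
    by (simp add: Suc_diff_le)
qed

text \<open>The description of right-to-left maxima with ZERO and DIST in place of LMA and VID: weak
  increase excludes smaller nonzero entries later, DIST excludes equal ones.\<close>

lemma rmi_iff:
  assumes "1 \<le> i" "i \<le> n"
  shows "i \<in> RMI n e \<longleftrightarrow> (\<forall>c\<in>{i<..n}. c \<notin> ZERO n e) \<and> (i \<in> ZERO n e \<or> i \<in> DIST n e)"
proof -
  have Z: "c \<in> ZERO n e \<longleftrightarrow> e c = 0" if "1 \<le> c" "c \<le> n" for c using that by (simp add: ZERO_def)
  have D: "i \<in> DIST n e \<longleftrightarrow> e i \<noteq> 0 \<and> (\<forall>j\<in>{i<..n}. e i \<noteq> e j)"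
    using lt[OF assms] assms by (auto simp: DIST_def)
  show ?thesis
  proof
    assume "i \<in> RMI n e"
    then have less: "e i < e j" if "i < j" "j \<le> n" for j using that by (simp add: RMI_def)
    then show "(\<forall>c\<in>{i<..n}. c \<notin> ZERO n e) \<and> (i \<in> ZERO n e \<or> i \<in> DIST n e)"
    proof -
      have "c \<notin> ZERO n e" "e i \<noteq> e c" if "c \<in> {i<..n}" for c
        using less[of c] Z[of c] that assms by auto
      then show ?thesis using D Z[OF assms] by blast
    qed
  next
    assume h: "(\<forall>c\<in>{i<..n}. c \<notin> ZERO n e) \<and> (i \<in> ZERO n e \<or> i \<in> DIST n e)"
    have "e i < e j" if j: "i < j" "j \<le> n" for j
    proof -
      have jn: "j \<in> {i<..n}" "1 \<le> j" using j by auto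
      then have "e j \<noteq> 0" using h Z[of j] j(2) by blast
      then have "e i \<le> e j" using mono[of i j] assms j by simp
      moreover have "e i \<noteq> e j"
      proof (cases "e i = 0")
        case True
        then show ?thesis using \<open>e j \<noteq> 0\<close> by simp
      next
        case False
        then have "i \<in> DIST n e" using h Z[OF assms] by simp
        then have "\<forall>j\<in>{i<..n}. e i \<noteq> e j" using D by simp
        then show ?thesis using jn(1) by (rule bspec)
      qed
      ultimately show ?thesis by simp
    qed
    then show "i \<in> RMI n e" using assms by (simp add: RMI_def)
  qed
qed

text \<open>After an ascent all later nonzero entries are at least \<open>e (Suc i)\<close>, so a
  nonzero value \<open>e i\<close> does not return.\<close>

lemma asc_iff:
  assumes i: "1 \<le> i" "Suc i \<le> n"
  shows "i \<in> ASC n e \<longleftrightarrow> Suc i \<notin> ZERO n e \<and> (i \<in> ZERO n e \<or> i \<in> DIST n e)"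
proof -
  have A: "i \<in> ASC n e \<longleftrightarrow> e i < e (Suc i)" using i by (auto simp: ASC_def)
  have Z: "i \<in> ZERO n e \<longleftrightarrow> e i = 0" "Suc i \<in> ZERO n e \<longleftrightarrow> e (Suc i) = 0" using i by (simp_all add: ZERO_def)
  have D: "i \<in> DIST n e \<longleftrightarrow> e i \<noteq> 0 \<and> (\<forall>j\<in>{i<..n}. e i \<noteq> e j)"
    using lt[of i] i by (auto simp: DIST_def)
  show ?thesis unfolding A Z D
  proof
    assume a: "e i < e (Suc i)"
    have "e i \<noteq> e j" if "e i \<noteq> 0" "j \<in> {i<..n}" for j
    proof (cases "j = Suc i")
      case True
      then show ?thesis using a by simp
    next
      case False
      then show ?thesis using mono[of "Suc i" j] that a by (cases "e j = 0") auto
    qed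
    moreover have "e (Suc i) \<noteq> 0" using a by simp
    ultimately show "e (Suc i) \<noteq> 0 \<and> (e i = 0 \<or> e i \<noteq> 0 \<and> (\<forall>j\<in>{i<..n}. e i \<noteq> e j))" by blast
  next
    assume h: "e (Suc i) \<noteq> 0 \<and> (e i = 0 \<or> e i \<noteq> 0 \<and> (\<forall>j\<in>{i<..n}. e i \<noteq> e j))"
    then have "e i \<le> e (Suc i)" using mono[of i "Suc i"] i by simp
    moreover have "e i \<noteq> e (Suc i)" using h i by auto
    ultimately show "e i < e (Suc i)" by simp
  qed
qed

end

section \<open>The bijection\<close>

definition valid_lists :: "nat \<Rightarrow> nat list set" where
  "valid_lists n = {xs. length xs = n \<and> valid 0 xs}"

lemma seq_codes_bij: "bij_betw (seq_codes n) (inv_seqs_021 n) (valid_lists n)"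
proof (rule bij_betw_imageI)
  show "inj_on (seq_codes n) (inv_seqs_021 n)"
  proof (rule inj_onI)
    fix e f assume ef: "e \<in> inv_seqs_021 n" "f \<in> inv_seqs_021 n" "seq_codes n e = seq_codes n f"
    interpret E: seq_021 n e by unfold_locales fact
    interpret F: seq_021 n f by unfold_locales fact
    show "e = f"
    proof (rule PiE_ext)
      show "e \<in> (\<Pi>\<^sub>E i\<in>{1..n}. {0..<i})" "f \<in> (\<Pi>\<^sub>E i\<in>{1..n}. {0..<i})"
        using ef unfolding inv_seqs_021_def inv_seqs_def by blast+
      fix i assume i: "i \<in> {1..n}"
      then have "i - 1 < n" "Suc (i - 1) = i" by auto
      then have "seq_code e i = seq_code f i"
        using seq_codes_nth[of "i - 1" n e] seq_codes_nth[of "i - 1" n f] ef(3) by simp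
      then show "e i = f i" using E.lt[of i] F.lt[of i] i by (auto simp: seq_code_def split: if_splits)
    qed
  qed
  show "seq_codes n ` inv_seqs_021 n = valid_lists n"
  proof (intro set_eqI iffI)
    fix xs assume "xs \<in> seq_codes n ` inv_seqs_021 n"
    then show "xs \<in> valid_lists n"
      using seq_021.valid_seq_codes seq_021.intro by (auto simp: valid_lists_def)
  next
    fix xs assume "xs \<in> valid_lists n"
    then have len: "length xs = n" and le: "\<And>i. i < n \<Longrightarrow> xs ! i \<le> i"
      and inc: "\<And>p i. p < i \<Longrightarrow> i < n \<Longrightarrow> xs ! p \<noteq> 0 \<Longrightarrow> xs ! i \<le> xs ! p + (i - p)"
      by (auto simp: valid_lists_def valid_iff_nth)
    define e where "e = (\<lambda>i\<in>{1..n}. if xs ! (i - 1) = 0 then 0 else i - xs ! (i - 1))"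
    have e: "e i = (if xs ! (i - 1) = 0 then 0 else i - xs ! (i - 1))" if "1 \<le> i" "i \<le> n" for i
      using that by (simp add: e_def)
    have "e \<in> inv_seqs n" unfolding inv_seqs_def
    proof (rule PiE_I)
      fix i assume "i \<in> {1..n}"
      then show "e i \<in> {0..<i}" using le[of "i - 1"] e[of i] by auto
    qed (auto simp: e_def)
    moreover have "e i \<le> e j" if "1 \<le> i" "i < j" "j \<le> n" "e i \<noteq> 0" "e j \<noteq> 0" for i j
    proof -
      have xi: "xs ! (i - 1) \<noteq> 0" "e i = i - xs ! (i - 1)" "e j = j - xs ! (j - 1)"
        using that e[of i] e[of j] by (auto split: if_splits)
      have "i - 1 < j - 1" "j - 1 < n" "j - 1 - (i - 1) = j - i" using that by auto
      then have "xs ! (j - 1) \<le> xs ! (i - 1) + (j - i)" using inc[of "i - 1" "j - 1"] xi(1) by metis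
      then show ?thesis using xi(2,3) that by linarith
    qed
    ultimately have "e \<in> inv_seqs_021 n" unfolding inv_seqs_021_iff by blast
    moreover have "seq_codes n e = xs"
    proof (rule nth_equalityI)
      fix i assume "i < length (seq_codes n e)"
      then show "seq_codes n e ! i = xs ! i"
        using le[of i] e[of "Suc i"] by (auto simp: seq_codes_nth seq_code_def)
    qed (simp add: len)
    ultimately show "xs \<in> seq_codes n ` inv_seqs_021 n" by blast
  qed
qed

lemma codes_bij: "bij_betw (codes n) (perms_2413_4213 n) (valid_lists n)"
proof (rule bij_betw_imageI)
  have P: "\<pi> \<in> perms_2413_4213 n \<longleftrightarrow> avoider n \<pi>" for \<pi>
    by (simp add: perms_2413_4213_eq avoider_def)
  show "inj_on (codes n) (perms_2413_4213 n)"
    using codes_inj unfolding P by (auto intro: inj_onI simp: P)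
  show "codes n ` perms_2413_4213 n = valid_lists n"
  proof (intro set_eqI iffI)
    fix xs assume "xs \<in> codes n ` perms_2413_4213 n"
    then show "xs \<in> valid_lists n" using avoider.valid_codes[of n _ n] by (auto simp: P valid_lists_def)
  next
    fix xs assume "xs \<in> valid_lists n"
    then obtain \<pi> where "avoider n \<pi>" "codes n \<pi> = xs"
      using codes_surj[of xs] by (auto simp: valid_lists_def)
    then show "xs \<in> codes n ` perms_2413_4213 n" using P by blast
  qed
qed

text \<open>The range of the injection \<open>enc\<close> is the set of nonempty valid lists, so
  \<open>inv enc\<close> decodes these only.\<close>

definition rotate_code :: "nat list \<Rightarrow> nat list" where
  "rotate_code xs = enc (rot_subs (inv enc xs))"

lemma enc_inv_enc:
  assumes "1 \<le> n" "xs \<in> valid_lists n"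
  shows "enc (inv enc xs) = xs"
proof -
  have "valid 0 xs" "xs \<noteq> []" using assms by (auto simp: valid_lists_def)
  then have "xs \<in> range enc" using enc_surj[of xs] by blast
  then show ?thesis by (rule f_inv_into_f)
qed

text \<open>On a finite set injectivity suffices, which avoids constructing an inverse rotation.
  Finiteness comes from the permutations through \<open>codes\<close>.\<close>

lemma rotate_code_bij:
  assumes "1 \<le> n"
  shows "bij_betw rotate_code (valid_lists n) (valid_lists n)"
proof -
  note dec = enc_inv_enc[OF assms]
  have fin: "finite (valid_lists n)"
  proof -
    have "finite (perms_2413_4213 n)"
      by (rule finite_subset[OF _ finite_permutations[of "{1..n}"]]) (auto simp: perms_2413_4213_def)
    then show ?thesis using codes_bij[of n] bij_betw_finite by blast
  qed
  have "rotate_code ` valid_lists n \<subseteq> valid_lists n"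
  proof
    fix ys assume "ys \<in> rotate_code ` valid_lists n"
    then obtain xs where xs: "xs \<in> valid_lists n" "ys = rotate_code xs" by blast
    then have "length ys = n"
      using dec[OF xs(1)] length_enc_rot_subs[of "inv enc xs"] by (simp add: rotate_code_def valid_lists_def)
    then show "ys \<in> valid_lists n" using valid_enc xs(2) by (simp add: valid_lists_def rotate_code_def)
  qed
  moreover have "inj_on rotate_code (valid_lists n)"
  proof (rule inj_onI)
    fix xs ys assume h: "xs \<in> valid_lists n" "ys \<in> valid_lists n" "rotate_code xs = rotate_code ys"
    then have "inv enc xs = inv enc ys" unfolding rotate_code_def using enc_inj rot_subs_inj by blast
    then show "xs = ys" using dec h by metis
  qed
  ultimately show ?thesis using endo_inj_surj[OF fin] by (simp add: bij_betw_def)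
qed

lemma rotate_code_flags:
  assumes "1 \<le> n" "xs \<in> valid_lists n"
  shows "vid_flags (rotate_code xs) = dist_flags xs"
    "rmi_flags 0 (rotate_code xs) = expo_flags False 0 xs"
    "\<And>i. i < n \<Longrightarrow> rotate_code xs ! i = 0 \<longleftrightarrow> xs ! i = 0"
    "\<And>i. i < n \<Longrightarrow> rotate_code xs ! i = 1 \<longleftrightarrow> xs ! i = 1"
proof -
  let ?w = "inv enc xs"
  have dec: "enc ?w = xs" by (rule enc_inv_enc[OF assms])
  show "vid_flags (rotate_code xs) = dist_flags xs"
    using vid_flags_enc_rot_subs[of ?w] dec by (simp add: rotate_code_def)
  show "rmi_flags 0 (rotate_code xs) = expo_flags False 0 xs"
    using rmi_flags_enc_rot_subs[of ?w] dec by (simp add: rotate_code_def)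
  have len: "length (rotate_code xs) = n" "length xs = n"
    using assms length_enc_rot_subs[of ?w] dec by (auto simp: valid_lists_def rotate_code_def)
  fix i assume i: "i < n"
  show "rotate_code xs ! i = 0 \<longleftrightarrow> xs ! i = 0"
    using arg_cong[OF enc_rot_subs_zeros[of ?w], of "\<lambda>l. l ! i"] dec i len
    by (simp add: rotate_code_def)
  show "rotate_code xs ! i = 1 \<longleftrightarrow> xs ! i = 1"
    using arg_cong[OF enc_rot_subs_ones[of ?w], of "\<lambda>l. l ! i"] dec i len
    by (simp add: rotate_code_def)
qed

lemma statistics_agree:
  assumes n: "1 \<le> n" and e: "e \<in> inv_seqs_021 n" and p: "\<pi> \<in> perms_2413_4213 n"
    and c: "codes n \<pi> = rotate_code (seq_codes n e)"
  shows "DIST n e = VID n \<pi> \<and> ASC n e = DES n \<pi> \<and> ZERO n e = LMA n \<pi> \<and>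
    EMA n e = LMI n \<pi> \<and> RMI n e = RMA n \<pi> \<and> EXPO n e = RMI n \<pi>"
proof -
  interpret S: seq_021 n e by unfold_locales fact
  interpret P: avoider n \<pi> using p by (simp add: perms_2413_4213_eq avoider_def)
  have xs: "seq_codes n e \<in> valid_lists n" using seq_codes_bij[of n] e by (auto simp: bij_betw_def)
  note fl = rotate_code_flags[OF n xs, folded c]
  have flag: "A = B" if "A \<subseteq> {1..n}" "B \<subseteq> {1..n}" "\<And>i. i < n \<Longrightarrow> Suc i \<in> A \<longleftrightarrow> Suc i \<in> B" for A B
  proof (intro set_eqI)
    fix k
    show "k \<in> A \<longleftrightarrow> k \<in> B" using that(3)[of "k - 1"] that(1,2) by (cases "k \<in> {1..n}") auto
  qed
  have D: "DIST n e = VID n \<pi>"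
  proof (rule flag)
    show "DIST n e \<subseteq> {1..n}" "VID n \<pi> \<subseteq> {1..n}" by (auto simp: DIST_def VID_def)
  qed (simp add: S.dist_iff_flag P.vid_iff_flag fl)
  have Z: "ZERO n e = LMA n \<pi>"
  proof (rule flag)
    show "ZERO n e \<subseteq> {1..n}" "LMA n \<pi> \<subseteq> {1..n}" by (auto simp: ZERO_def LMA_def)
  qed (simp add: S.zero_iff_flag P.lma_iff_flag fl)
  have M: "EMA n e = LMI n \<pi>"
  proof (rule flag)
    show "EMA n e \<subseteq> {1..n}" "LMI n \<pi> \<subseteq> {1..n}" by (auto simp: EMA_def LMI_def)
  qed (simp add: S.ema_iff_flag P.lmi_iff_flag fl del: One_nat_def)
  have X: "EXPO n e = RMI n \<pi>"
  proof (rule flag)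
    show "EXPO n e \<subseteq> {1..n}" "RMI n \<pi> \<subseteq> {1..n}" by (auto simp: EXPO_def RMI_def)
  qed (simp add: S.expo_iff_flag P.rmi_iff_flag fl)
  have R: "RMI n e = RMA n \<pi>"
  proof (rule flag)
    show "RMI n e \<subseteq> {1..n}" "RMA n \<pi> \<subseteq> {1..n}" by (auto simp: RMI_def RMA_def)
  qed (simp add: S.rmi_iff P.rma_iff D Z)
  have A: "ASC n e = DES n \<pi>"
  proof (rule flag)
    show sub: "ASC n e \<subseteq> {1..n}" "DES n \<pi> \<subseteq> {1..n}" by (auto simp: ASC_def DES_def)
    fix i assume "i < n"
    show "Suc i \<in> ASC n e \<longleftrightarrow> Suc i \<in> DES n \<pi>"
    proof (cases "Suc (Suc i) \<le> n")
      case True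
      then show ?thesis by (simp add: S.asc_iff P.des_iff D Z)
    next
      case False
      \<comment> \<open>Position \<open>n\<close> is outside both sets, as they are confined to
        \<open>{1..n-1}\<close>.\<close>
      then have "\<not> Suc i \<le> n - 1" by linarith
      then show ?thesis by (simp add: ASC_def DES_def)
    qed
  qed
  show ?thesis using D A Z M R X by blast
qed

theorem theorem3p5:
  fixes n :: nat
  assumes "n \<ge> 1"
  shows "\<exists>\<Psi> :: (nat \<Rightarrow> nat) \<Rightarrow> (nat \<Rightarrow> nat).
    bij_betw \<Psi> (inv_seqs_021 n) (perms_2413_4213 n) \<and>
    (\<forall>e \<in> inv_seqs_021 n.
       DIST n e = VID n (\<Psi> e) \<and>
       ASC n e = DES n (\<Psi> e) \<and>
       ZERO n e = LMA n (\<Psi> e) \<and>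
       EMA n e = LMI n (\<Psi> e) \<and>
       RMI n e = RMA n (\<Psi> e) \<and>
       EXPO n e = RMI n (\<Psi> e))"
proof -
  let ?S = "perms_2413_4213 n"
  define \<Psi> where "\<Psi> = the_inv_into ?S (codes n) \<circ> (rotate_code \<circ> seq_codes n)"
  have bij1: "bij_betw (rotate_code \<circ> seq_codes n) (inv_seqs_021 n) (valid_lists n)"
    using bij_betw_trans[OF seq_codes_bij rotate_code_bij[OF assms]] .
  then have bij: "bij_betw \<Psi> (inv_seqs_021 n) ?S"
    unfolding \<Psi>_def using bij_betw_trans[OF _ bij_betw_the_inv_into[OF codes_bij]] by blast
  have "codes n (\<Psi> e) = rotate_code (seq_codes n e)" if "e \<in> inv_seqs_021 n" for e
    using f_the_inv_into_f_bij_betw[OF codes_bij[of n], of "rotate_code (seq_codes n e)"]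
      bij_betwE[OF bij1] that by (auto simp: \<Psi>_def)
  then show ?thesis using bij statistics_agree[OF assms] bij_betwE[OF bij] by (intro exI[of _ \<Psi>]) blast
qed

end
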